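(* Let $\Omega_D\subset\mathbb{R}_*^{p+q+1}$ be a bounded ($p$-symmetric) domain and let $t>q$. Then the Teodorescu transform $$T_{\Omega_D}f(\boldsymbol{x})=-\int_{\Omega_D}K_{\boldsymbol{y}}(\boldsymbol{x})f(\boldsymbol{y})\,d\sigma(\boldsymbol{y})$$ defines a continuous map $T_{\Omega_D}:\mathcal{L}^t(\Omega_D)\to\mathcal{L}^t(\Omega_D)$, where $\mathcal{L}^t(\Omega_D)=L^t(\Omega_D)\cap\mathcal{GS}(\Omega_D)$ is the space of $\mathbb{R}_{p+q}$-valued $L^t$ generalized partial-slice functions on $\Omega_D$, with the $L^t$ norm.
   Context: Let $p\ge 0$ and $q\ge 1$ be integers. $\mathbb{R}_{p+q}$ is the real Clifford algebra generated by $e_1,\dots,e_{p+q}$ with $e_ie_j+e_je_i=-2\delta_{ij}$, and $e_0=1$. Clifford conjugation is the linear anti-involution with $\overline{e_0}=e_0$, $\overline{e_j}=-e_j$ for $1\le j\le p+q$. The norm of $a=\sum_A a_Ae_A$ is $|a|=(\sum_A a_A^2)^{1/2}$, used to define $L^t$ norms of $\mathbb{R}_{p+q}$-valued functions. A point of $\mathbb{R}^{p+q+1}=\mathbb{R}^{p+1}\oplus\mathbb{R}^q$ is identified with the paravector $\boldsymbol{x}=\boldsymbol{x}_p+\underline{\boldsymbol{x}}_q$, $\boldsymbol{x}_p=\sum_{i=0}^p x_ie_i$, $\underline{\boldsymbol{x}}_q=\sum_{i=p+1}^{p+q}x_ie_i$. $\mathbb{S}=\{\underline{\boldsymbol{x}}_q:\underline{\boldsymbol{x}}_q^2=-1\}$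 is the unit sphere of $\mathbb{R}^q$, and $\sigma_{q-1}$ is its area. Write $\boldsymbol{x}=\boldsymbol{x}_p+r\underline{\omega}$ with $r=|\underline{\boldsymbol{x}}_q|\ge 0$, $\underline{\omega}=\underline{\boldsymbol{x}}_q/|\underline{\boldsymbol{x}}_q|\in\mathbb{S}$ when $\underline{\boldsymbol{x}}_q\ne0$. Set $\mathbb{R}_*^{p+q+1}=\mathbb{R}^{p+q+1}\setminus\mathbb{R}^{p+1}$. A domain $\Omega$ is $p$-symmetric if $\boldsymbol{x}_p+r\underline{\omega}\in\Omega$ (with $\boldsymbol{x}_p\in\mathbb{R}^{p+1}$, $r>0$, $\underline{\omega}\in\mathbb{S}$) implies $\boldsymbol{x}_p+r\mathbb{S}\subseteq\Omega$. The notation $\Omega_D$ denotes a $p$-symmetric domain, written as the $p$-symmetric completion $\Omega_D=\{\boldsymbol{x}_p+r\underline{\omega}:\underline{\omega}\in\mathbb{S},\ r\ge0,\ (\boldsymbol{x}_p,r)\in D\}$ of an open set $D\subset\mathbb{R}^{p+2}$ invariant under $(\boldsymbol{x}_p,r)\mapsto(\boldsymbol{x}_p,-r)$. A stem function on $D$ is $F=F_1+iF_2:D\to\mathbb{R}_{p+q}\otimes_{\mathbb{R}}\mathbb{C}$ with $F_1,F_2$ being $\mathbb{R}_{p+q}$-valued, $F_1(\boldsymbol{x}_p,-r)=F_1(\boldsymbol{x}_p,r)$ and $F_2(\boldsymbol{x}_p,-r)=-F_2(\boldsymbol{x}_p,r)$. It induces the generalized partial-slice function $\mathcal{I}(F):\Omega_D\to\mathbb{R}_{p+q}$,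 $\mathcal{I}(F)(\boldsymbol{x}_p+r\underline{\omega})=F_1(\boldsymbol{x}_p,r)+\underline{\omega}F_2(\boldsymbol{x}_p,r)$. $\mathcal{GS}(\Omega_D)$ is the set of all such functions (in $\mathcal{L}^t(\Omega_D)$ functions are identified when equal almost everywhere). The monogenic Cauchy kernel is $E(\boldsymbol{x})=\frac{1}{\sigma_{p+1}}\frac{\overline{\boldsymbol{x}}}{|\boldsymbol{x}|^{p+2}}$, with $\sigma_{p+1}=2\Gamma(\tfrac12)^{p+2}/\Gamma(\tfrac{p+2}{2})$ the area of the unit sphere in $\mathbb{R}^{p+2}$, and $E_{\boldsymbol{y}}(\boldsymbol{x})=E(\boldsymbol{y}-\boldsymbol{x})$. For $\boldsymbol{y}\in\mathbb{R}_*^{p+q+1}$ with $\underline{\eta}=\underline{\boldsymbol{y}}_q/|\underline{\boldsymbol{y}}_q|$ and $\boldsymbol{x}=\boldsymbol{x}_p+r\underline{\omega}$, $$\mathcal{E}_{\boldsymbol{y}}(\boldsymbol{x})=\tfrac12(1-\underline{\omega}\,\underline{\eta})E_{\boldsymbol{y}}(\boldsymbol{x}_p+r\underline{\eta})+\tfrac12(1+\underline{\omega}\,\underline{\eta})E_{\boldsymbol{y}}(\boldsymbol{x}_p-r\underline{\eta}),\qquad K_{\boldsymbol{y}}(\boldsymbol{x})=\frac{\mathcal{E}_{\boldsymbol{y}}(\boldsymbol{x})}{\sigma_{q-1}|\underline{\boldsymbol{y}}_q|^{q-1}}.$$ $d\sigma$ is Lebesgue measure on $\Omega_D\subset\mathbb{R}^{p+q+1}$.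 *)

theory Defs
  imports "HOL-Analysis.Analysis"
begin

section \<open>The Clifford algebra\<close>

text \<open>
  The generators \<open>e\<^sub>1, \<dots>, e\<^sub>n\<close> are indexed by a finite linearly ordered type \<open>'n\<close>, and an element
  \<open>a = \<Sum>\<^sub>A a\<^sub>A e\<^sub>A\<close> is the vector of its coefficients; here \<open>e\<^sub>A\<close> is the product of the \<open>e\<^sub>j\<close>, \<open>j \<in> A\<close>,
  in increasing order, and \<open>e\<^sub>A = 1\<close> for \<open>A = {}\<close>.  The norm of the type is
  \<open>(\<Sum>\<^sub>A a\<^sub>A\<^sup>2)\<^sup>1\<^sup>/\<^sup>2\<close>.
\<close>

type_synonym 'n clifford = "real ^ ('n set)"

text \<open>
  \<open>e\<^sub>A e\<^sub>B = cl_sign A B e\<^sub>C\<close> with \<open>C\<close> the symmetric difference of \<open>A\<close> and \<open>B\<close>: sorting the factors costs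
  one sign for every pair \<open>i \<in> A\<close>, \<open>j \<in> B\<close> with \<open>j < i\<close>, and cancelling \<open>e\<^sub>i\<^sup>2 = -1\<close> one sign for every
  \<open>i \<in> A \<inter> B\<close>.
\<close>

definition cl_sign :: "'n::{finite,linorder} set \<Rightarrow> 'n set \<Rightarrow> real" where
  "cl_sign A B = (\<Prod>i\<in>A. \<Prod>j\<in>B. if j \<le> i then - 1 else 1)"

definition cl_mult :: "'n::{finite,linorder} clifford \<Rightarrow> 'n clifford \<Rightarrow> 'n clifford" (infixl "\<odot>" 70) where
  "a \<odot> b = (\<chi> C. \<Sum>(A, B) \<in> {(A, B). sym_diff A B = C}. cl_sign A B * a $ A * b $ B)"

definition cl_one :: "'n::{finite,linorder} clifford" where
  "cl_one = axis {} 1"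

text \<open>The units \<open>e\<^sub>0 = 1\<close> (index \<^term>\<open>None\<close>) and \<open>e\<^sub>j\<close> (index \<^term>\<open>Some j\<close>).\<close>

definition cl_unit :: "'n::{finite,linorder} option \<Rightarrow> 'n clifford" where
  "cl_unit i = axis (set_option i) 1"

text \<open>
  Clifford conjugation: an anti-involution with \<open>e\<^sub>j \<mapsto> - e\<^sub>j\<close> sends \<open>e\<^sub>A\<close>, \<open>card A = k\<close>, to
  \<open>(-1)\<^sup>k\<close> times the reversed product, i.e. to \<open>(-1)\<^sup>k (-1)\<^bsup>k(k-1)/2\<^esup> e\<^sub>A\<close>.
\<close>

definition cl_conj :: "'n::{finite,linorder} clifford \<Rightarrow> 'n clifford" where
  "cl_conj a = (\<chi> A. (- 1) ^ (card A * (card A + 1) div 2) * a $ A)"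

lemma sym_diff_cancel: "sym_diff A (sym_diff A B) = B"
  by auto

lemma cl_mult_nth: "(a \<odot> b) $ C = (\<Sum>A\<in>UNIV. cl_sign A (sym_diff A C) * a $ A * b $ (sym_diff A C))"
proof -
  have "(\<Sum>(A, B) \<in> {(A, B). sym_diff A B = C}. cl_sign A B * a $ A * b $ B)
     = (\<Sum>A\<in>UNIV. cl_sign A (sym_diff A C) * a $ A * b $ (sym_diff A C))"
    by (rule sum.reindex_bij_witness[where i = "\<lambda>A. (A, sym_diff A C)" and j = fst])
      (auto simp only: mem_Collect_eq case_prod_conv fst_conv sym_diff_cancel)
  then show ?thesis by (simp add: cl_mult_def)
qed

lemma sign_square: "(if P then - 1 else 1) * (if P then - 1 else (1::real)) = 1"
  by simp

lemma prod_sym_diff: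
  fixes g :: "'a::finite \<Rightarrow> real"
  assumes "\<And>i. g i * g i = 1"
  shows "(\<Prod>i\<in>sym_diff A B. g i) = (\<Prod>i\<in>A. g i) * (\<Prod>i\<in>B. g i)"
proof -
  have A: "prod g A = prod g (A - B) * prod g (A \<inter> B)"
    by (subst prod.union_disjoint[symmetric]) (auto intro!: prod.cong)
  have B: "prod g B = prod g (B - A) * prod g (A \<inter> B)"
    by (subst prod.union_disjoint[symmetric]) (auto intro!: prod.cong)
  have S: "prod g (sym_diff A B) = prod g (A - B) * prod g (B - A)"
    by (rule prod.union_disjoint) auto
  have "prod g (A \<inter> B) * prod g (A \<inter> B) = 1"
    by (simp add: prod.distrib[symmetric] assms)
  then show ?thesis unfolding A B S by (simp add: algebra_simps)
qed

lemma cl_sign_sym_diff_left: "cl_sign (sym_diff A B) C = cl_sign A C * cl_sign B C"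
  unfolding cl_sign_def by (rule prod_sym_diff) (simp only: prod.distrib[symmetric] sign_square prod.neutral_const)

lemma cl_sign_sym_diff_right: "cl_sign A (sym_diff B C) = cl_sign A B * cl_sign A C"
  unfolding cl_sign_def prod.distrib[symmetric]
  by (rule prod.cong[OF refl], rule prod_sym_diff, rule sign_square)

lemma cl_mult_assoc: "(a \<odot> b) \<odot> c = a \<odot> (b \<odot> c)"
proof (rule vec_eq_iff[THEN iffD2], rule allI)
  fix D
  have 1: "((a \<odot> b) \<odot> c) $ D = (\<Sum>A\<in>UNIV. \<Sum>C\<in>UNIV. cl_sign A (sym_diff A C) * cl_sign C (sym_diff C D)
      * a $ A * b $ (sym_diff A C) * c $ (sym_diff C D))"
    by (subst sum.swap) (simp add: cl_mult_nth sum_distrib_left sum_distrib_right mult_ac)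
  have 2: "(a \<odot> (b \<odot> c)) $ D = (\<Sum>A\<in>UNIV. \<Sum>B\<in>UNIV. cl_sign A (sym_diff A D)
      * cl_sign B (sym_diff B (sym_diff A D)) * a $ A * b $ B * c $ (sym_diff B (sym_diff A D)))"
    by (simp add: cl_mult_nth sum_distrib_left mult_ac)
  have 3: "(\<Sum>C\<in>UNIV. cl_sign A (sym_diff A C) * cl_sign C (sym_diff C D)
      * a $ A * b $ (sym_diff A C) * c $ (sym_diff C D))
    = (\<Sum>B\<in>UNIV. cl_sign A (sym_diff A D)
      * cl_sign B (sym_diff B (sym_diff A D)) * a $ A * b $ B * c $ (sym_diff B (sym_diff A D)))" for A
  proof (rule sum.reindex_bij_witness[where i = "\<lambda>B. sym_diff A B" and j = "\<lambda>C. sym_diff A C"])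
    fix C
    define B where "B = sym_diff A C"
    have C: "C = sym_diff A B" by (auto simp: B_def)
    have E: "sym_diff B (sym_diff A D) = sym_diff C D" by (auto simp: B_def)
    have D: "sym_diff A D = sym_diff B (sym_diff C D)" by (auto simp: B_def)
    show "cl_sign A (sym_diff A D) * cl_sign (sym_diff A C) (sym_diff (sym_diff A C) (sym_diff A D)) * a $ A *
      b $ (sym_diff A C) * c $ (sym_diff (sym_diff A C) (sym_diff A D)) =
      cl_sign A (sym_diff A C) * cl_sign C (sym_diff C D) * a $ A * b $ (sym_diff A C) * c $ (sym_diff C D)"
      unfolding B_def[symmetric] E
      by (subst D, subst (3) C) (simp only: cl_sign_sym_diff_left cl_sign_sym_diff_right mult_ac)
  qed auto
  show "((a \<odot> b) \<odot> c) $ D = (a \<odot> (b \<odot> c)) $ D"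
    unfolding 1 2 3 ..
qed

lemma cl_blade_mult: "axis A 1 \<odot> axis B 1 = cl_sign A B *\<^sub>R axis (sym_diff A B) (1::real)"
proof (rule vec_eq_iff[THEN iffD2], rule allI)
  fix C
  have "(axis A 1 \<odot> axis B 1) $ C
      = (\<Sum>A'\<in>UNIV. if A' = A then cl_sign A (sym_diff A C) * axis B 1 $ (sym_diff A C) else 0)"
    unfolding cl_mult_nth by (rule sum.cong) (auto simp: axis_def)
  also have "\<dots> = (cl_sign A B *\<^sub>R axis (sym_diff A B) 1) $ C"
  proof (cases "C = sym_diff A B")
    case True
    then have "sym_diff A C = B" by auto
    then show ?thesis using True by simp
  next
    case False
    then have "sym_diff A C \<noteq> B" by auto
    then show ?thesis using False by (simp add: axis_def)
  qed
  finally show "(axis A 1 \<odot> axis B 1) $ C = (cl_sign A B *\<^sub>R axis (sym_diff A B) 1) $ C" .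
qed

lemma cl_unit_None: "cl_unit None = cl_one"
  by (simp add: cl_unit_def cl_one_def)

lemma cl_one_mult:
  fixes a :: "'n::{finite,linorder} clifford"
  shows "cl_one \<odot> a = a" "a \<odot> cl_one = a"
proof -
  show "cl_one \<odot> a = a"
  proof (rule vec_eq_iff[THEN iffD2], rule allI)
    fix C
    have "(cl_one \<odot> a) $ C = (\<Sum>A::'n set\<in>UNIV. if A = {} then a $ C else 0)"
      unfolding cl_mult_nth
    proof (rule sum.cong)
      fix A
      show "cl_sign A (sym_diff A C) * cl_one $ A * a $ (sym_diff A C) = (if A = {} then a $ C else 0)"
        by (cases "A = {}") (auto simp: cl_one_def axis_def cl_sign_def)
    qed simp
    then show "(cl_one \<odot> a) $ C = a $ C" by simp
  qed
  show "a \<odot> cl_one = a"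
  proof (rule vec_eq_iff[THEN iffD2], rule allI)
    fix C
    have "(a \<odot> cl_one) $ C = (\<Sum>A\<in>UNIV. if A = C then a $ C else 0)"
      unfolding cl_mult_nth
    proof (rule sum.cong)
      fix A
      show "cl_sign A (sym_diff A C) * a $ A * cl_one $ (sym_diff A C) = (if A = C then a $ C else 0)"
      proof (cases "A = C")
        case False
        then have "sym_diff A C \<noteq> {}" by auto
        then have "cl_one $ (sym_diff A C) = 0"
          unfolding cl_one_def axis_def by (simp only: vec_lambda_beta if_False)
        then show ?thesis using False by simp
      qed (simp add: cl_one_def axis_def cl_sign_def)
    qed simp
    then show "(a \<odot> cl_one) $ C = a $ C" by simp
  qed
qed

lemma cl_generator_relation:
  fixes i j :: "'n::{finite,linorder}"
  shows "cl_unit (Some i) \<odot> cl_unit (Some j) + cl_unit (Some j) \<odot> cl_unit (Some i)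
     = (if i = j then - 2 else 0) *\<^sub>R cl_one"
proof -
  have 1: "cl_unit (Some k) \<odot> cl_unit (Some l)
      = (if l \<le> k then - 1 else 1) *\<^sub>R axis (sym_diff {k} {l}) 1" for k l :: 'n
    unfolding cl_unit_def option.set cl_blade_mult by (simp add: cl_sign_def)
  have 2: "sym_diff {j} {i} = sym_diff {i} {j}" by (rule Un_commute)
  show ?thesis
  proof (cases "i = j")
    case True
    then show ?thesis
      unfolding True 1 cl_one_def scaleR_left_distrib[symmetric] by simp
  next
    case False
    then show ?thesis
      unfolding 1 2 scaleR_left_distrib[symmetric] by (cases i j rule: linorder_cases) auto
  qed
qed

lemma cl_conj_unit: "cl_conj cl_one = cl_one" "cl_conj (cl_unit (Some j)) = - cl_unit (Some j)"
  by (auto simp: cl_conj_def cl_one_def cl_unit_def axis_def vec_eq_iff)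

lemma cl_conj_blade_sign:
  fixes A B :: "'n::{finite,linorder} set"
  shows "(- 1 :: real) ^ (card (sym_diff A B) * (card (sym_diff A B) + 1) div 2) * cl_sign A B
     = (- 1) ^ (card A * (card A + 1) div 2) * (- 1) ^ (card B * (card B + 1) div 2) * cl_sign B A"
proof -
  define m where "m = card (A \<inter> B)"
  define a where "a = card (A - B)"
  define b where "b = card (B - A)"
  have A: "card A = a + m"
    unfolding a_def m_def by (metis card_Diff_subset_Int Int_lower1 card_mono finite le_add_diff_inverse2)
  have B: "card B = b + m"
    unfolding b_def m_def
    by (metis card_Diff_subset_Int Int_lower1 Int_commute card_mono finite le_add_diff_inverse2)
  have S: "card (sym_diff A B) = a + b"
    unfolding a_def b_def by (rule card_Un_disjoint) auto
  have "cl_sign A B * cl_sign B A = (\<Prod>i\<in>A. \<Prod>j\<in>B. (if j \<le> i then - 1 else 1) * (if i \<le> j then - 1 else 1))"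
    unfolding cl_sign_def prod.distrib by (subst (3) prod.swap) (rule refl)
  also have "\<dots> = (\<Prod>i\<in>A. \<Prod>j\<in>B. (- 1) * (if i = j then - 1 else 1))"
    by (intro prod.cong) auto
  also have "\<dots> = (- 1) ^ (card A * card B) * (\<Prod>i\<in>A. \<Prod>j\<in>B. if i = j then - 1 else 1)"
    unfolding prod.distrib by (simp only: prod_constant power_mult[symmetric] mult.commute)
  also have "(\<Prod>i\<in>A. \<Prod>j\<in>B. if i = j then - 1 else (1::real)) = (\<Prod>i\<in>A. if i \<in> B then - 1 else 1)"
    by (intro prod.cong) auto
  also have "\<dots> = (- 1) ^ m"
    by (simp add: prod.If_cases m_def)
  finally have sAB: "cl_sign A B * cl_sign B A = (- 1) ^ (card A * card B + m)"
    by (simp add: power_add)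
  have sq: "cl_sign B A * cl_sign B A = 1"
    unfolding cl_sign_def by (simp only: prod.distrib[symmetric] sign_square prod.neutral_const)
  have "cl_sign A B = (cl_sign A B * cl_sign B A) * cl_sign B A"
    using sq by (simp add: mult.assoc)
  then have s: "cl_sign A B = (- 1) ^ (card A * card B + m) * cl_sign B A"
    using sAB by simp
  have T: "even (k * (k + 1))" for k :: nat by simp
  have "even ((a+b)*(a+b+1) div 2 + (card A * card B + m) + card A * (card A + 1) div 2
      + card B * (card B + 1) div 2)"
  proof -
    obtain x where x: "(a+b)*(a+b+1) = 2 * x" using T by blast
    obtain y where y: "(a+m)*(a+m+1) = 2 * y" using T by blast
    obtain z where z: "(b+m)*(b+m+1) = 2 * z" using T by blast
    obtain w where w: "m*(m+1) = 2 * w" using T by blast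
    have "2 * (x + ((a+m)*(b+m) + m) + y + z)
        = 2 * (2 * ((a + b)* (a + b + 1) div 2 + (a + b) * m + m * (m+1)))"
      using x y z by (simp add: algebra_simps)
    then have "x + ((a+m)*(b+m) + m) + y + z = 2 * ((a + b)* (a + b + 1) div 2 + (a + b) * m + m * (m+1))"
      by simp
    then have "even (x + ((a+m)*(b+m) + m) + y + z)"
      by (simp only: dvd_triv_left)
    then show ?thesis
      unfolding A B x y z by (simp only: nonzero_mult_div_cancel_left numeral_neq_zero not_False_eq_True)
  qed
  then show ?thesis
    unfolding S s
    by (auto simp: minus_one_power_iff)
qed

lemma cl_conj_mult: "cl_conj (a \<odot> b) = cl_conj b \<odot> cl_conj a"
proof (rule vec_eq_iff[THEN iffD2], rule allI)
  fix C
  let ?c = "\<lambda>A. (- 1 :: real) ^ (card A * (card A + 1) div 2)"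
  have "cl_conj (a \<odot> b) $ C
      = (\<Sum>A\<in>UNIV. (?c C * cl_sign A (sym_diff A C)) * a $ A * b $ (sym_diff A C))"
    by (simp add: cl_conj_def cl_mult_nth sum_distrib_left mult_ac)
  also have "\<dots> = (\<Sum>B\<in>UNIV. cl_sign B (sym_diff B C) * (?c B * b $ B) * (?c (sym_diff B C) * a $ (sym_diff B C)))"
  proof (rule sum.reindex_bij_witness[where i = "\<lambda>B. sym_diff B C" and j = "\<lambda>A. sym_diff A C"])
    fix A
    define B where "B = sym_diff A C"
    have C: "C = sym_diff A B" and A: "sym_diff B C = A" by (auto simp: B_def)
    show "cl_sign (sym_diff A C) (sym_diff (sym_diff A C) C) * (?c (sym_diff A C) * b $ (sym_diff A C))
        * (?c (sym_diff (sym_diff A C) C) * a $ (sym_diff (sym_diff A C) C))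
      = (?c C * cl_sign A (sym_diff A C)) * a $ A * b $ (sym_diff A C)"
      unfolding B_def[symmetric] A
      unfolding C cl_conj_blade_sign by (simp add: mult_ac)
  qed auto
  also have "\<dots> = (cl_conj b \<odot> cl_conj a) $ C"
    by (simp add: cl_conj_def cl_mult_nth)
  finally show "cl_conj (a \<odot> b) $ C = (cl_conj b \<odot> cl_conj a) $ C" .
qed


section \<open>Paravectors\<close>

text \<open>
  Coordinate \<^term>\<open>None\<close> is \<open>x\<^sub>0\<close>, coordinate \<^term>\<open>Some j\<close> is \<open>x\<^sub>j\<close>.  When \<open>CARD('n) = p + q\<close> this is
  \<open>\<real>\<^bsup>p+q+1\<^esup>\<close>; the splitting into \<open>\<real>\<^bsup>p+1\<^esup>\<close> and \<open>\<real>\<^sup>q\<close> is an inner one, since \<open>p = 0\<close>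
  rules out an index type of cardinality \<open>p\<close>.
\<close>

type_synonym 'n paravector = "real ^ ('n option)"

definition para :: "'n::{finite,linorder} paravector \<Rightarrow> 'n clifford" where
  "para x = (\<Sum>i\<in>UNIV. x $ i *\<^sub>R cl_unit i)"

text \<open>The indices \<open>0, \<dots>, p\<close>; \<^term>\<open>Some j\<close> is the \<open>k\<close>-th generator if \<open>card {i. i \<le> j} = k\<close>.\<close>

definition p_indices :: "nat \<Rightarrow> 'n::{finite,linorder} option set" where
  "p_indices p = insert None (Some ` {j. card {i. i \<le> j} \<le> p})"

definition p_part :: "nat \<Rightarrow> 'n::{finite,linorder} paravector \<Rightarrow> 'n paravector" where
  "p_part p x = (\<chi> i. if i \<in> p_indices p then x $ i else 0)"

definition q_part :: "nat \<Rightarrow> 'n::{finite,linorder} paravector \<Rightarrow> 'n paravector" where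
  "q_part p x = (\<chi> i. if i \<in> p_indices p then 0 else x $ i)"

text \<open>\<open>\<real>\<^bsup>p+1\<^esup>\<close> and \<open>\<real>\<^sup>q\<close> as subspaces of \<open>\<real>\<^bsup>p+q+1\<^esup>\<close>.\<close>

definition p_space :: "nat \<Rightarrow> 'n::{finite,linorder} paravector set" where
  "p_space p = {x. q_part p x = 0}"

definition q_space :: "nat \<Rightarrow> 'n::{finite,linorder} paravector set" where
  "q_space p = {x. p_part p x = 0}"

definition q_sphere :: "nat \<Rightarrow> 'n::{finite,linorder} paravector set" where
  "q_sphere p = {\<omega> \<in> q_space p. para \<omega> \<odot> para \<omega> = - cl_one}"

text \<open>\<open>x\<^sub>q / |x\<^sub>q|\<close>, only meaningful off \<^term>\<open>p_space p\<close> (elsewhere it is 0).\<close>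

definition q_dir :: "nat \<Rightarrow> 'n::{finite,linorder} paravector \<Rightarrow> 'n paravector" where
  "q_dir p x = q_part p x /\<^sub>R norm (q_part p x)"


section \<open>Symmetric domains and generalized partial-slice functions\<close>

definition p_symmetric :: "nat \<Rightarrow> 'n::{finite,linorder} paravector set \<Rightarrow> bool" where
  "p_symmetric p \<Omega> \<longleftrightarrow>
     (\<forall>x \<in> p_space p. \<forall>r > 0. \<forall>\<omega> \<in> q_sphere p. x + r *\<^sub>R \<omega> \<in> \<Omega> \<longrightarrow> (\<forall>\<eta> \<in> q_sphere p. x + r *\<^sub>R \<eta> \<in> \<Omega>))"

text \<open>The sets \<open>D \<subseteq> \<real>\<^bsup>p+2\<^esup> = \<real>\<^bsup>p+1\<^esup> \<times> \<real>\<close>, open there and invariant under \<open>r \<mapsto> - r\<close>.\<close>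

definition stem_set :: "nat \<Rightarrow> ('n::{finite,linorder} paravector \<times> real) set \<Rightarrow> bool" where
  "stem_set p D \<longleftrightarrow> openin (top_of_set (p_space p \<times> UNIV)) D \<and> (\<forall>x r. (x, r) \<in> D \<longrightarrow> (x, - r) \<in> D)"

definition p_completion ::
    "nat \<Rightarrow> ('n::{finite,linorder} paravector \<times> real) set \<Rightarrow> 'n paravector set" where
  "p_completion p D = {x + r *\<^sub>R \<omega> | x r \<omega>. \<omega> \<in> q_sphere p \<and> 0 \<le> r \<and> (x, r) \<in> D}"

definition domain :: "'a::topological_space set \<Rightarrow> bool" where
  "domain \<Omega> \<longleftrightarrow> open \<Omega> \<and> connected \<Omega> \<and> \<Omega> \<noteq> {}"

text \<open>The stem function \<open>F\<^sub>1 + i F\<^sub>2\<close> is given by its two Clifford-valued components.\<close>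

definition stem_function :: "('n::{finite,linorder} paravector \<times> real) set \<Rightarrow>
    ('n paravector \<times> real \<Rightarrow> 'n clifford) \<Rightarrow> ('n paravector \<times> real \<Rightarrow> 'n clifford) \<Rightarrow> bool" where
  "stem_function D F\<^sub>1 F\<^sub>2 \<longleftrightarrow>
     (\<forall>(x, r) \<in> D. F\<^sub>1 (x, - r) = F\<^sub>1 (x, r) \<and> F\<^sub>2 (x, - r) = - F\<^sub>2 (x, r))"

definition GS :: "nat \<Rightarrow> ('n::{finite,linorder} paravector \<times> real) set \<Rightarrow>
    ('n paravector \<Rightarrow> 'n clifford) set" where
  "GS p D = {f. \<exists>F\<^sub>1 F\<^sub>2. stem_function D F\<^sub>1 F\<^sub>2 \<and>
     (\<forall>(x, r) \<in> D. \<forall>\<omega> \<in> q_sphere p. 0 \<le> r \<longrightarrow>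
        f (x + r *\<^sub>R \<omega>) = F\<^sub>1 (x, r) + para \<omega> \<odot> F\<^sub>2 (x, r))}"


section \<open>The spaces of functions with finite t-norm\<close>

text \<open>
  Functions are not divided by almost everywhere equality, so \<open>Lt_norm\<close> is a seminorm on \<open>Lt_space\<close>,
  vanishing exactly on the functions that are zero almost everywhere.  Accordingly an element of
  \<open>Lt_GS\<close> is only required to agree almost everywhere with a generalized partial-slice function.
\<close>

definition Lt_space :: "real \<Rightarrow> 'n::{finite,linorder} paravector set \<Rightarrow> ('n paravector \<Rightarrow> 'n clifford) set" where
  "Lt_space t \<Omega> = {f \<in> borel_measurable (lebesgue_on \<Omega>).
     integrable (lebesgue_on \<Omega>) (\<lambda>x. norm (f x) powr t)}"

definition Lt_norm :: "real \<Rightarrow> 'n::{finite,linorder} paravector set \<Rightarrow> ('n paravector \<Rightarrow> 'n clifford) \<Rightarrow> real" where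
  "Lt_norm t \<Omega> f = (\<integral>x. norm (f x) powr t \<partial>lebesgue_on \<Omega>) powr (1 / t)"

definition Lt_GS :: "nat \<Rightarrow> real \<Rightarrow> ('n::{finite,linorder} paravector \<times> real) set \<Rightarrow>
    ('n paravector \<Rightarrow> 'n clifford) set" where
  "Lt_GS p t D = {f \<in> Lt_space t (p_completion p D).
     \<exists>g \<in> GS p D. AE x in lebesgue_on (p_completion p D). f x = g x}"


section \<open>Kernels and the Teodorescu transform\<close>

text \<open>The area of the unit sphere in \<open>\<real>\<^sup>m\<close>, so that \<open>\<sigma>\<^bsub>m-1\<^esub> = sphere_area m\<close>.\<close>

definition sphere_area :: "nat \<Rightarrow> real" where
  "sphere_area m = 2 * Gamma (1 / 2) ^ m / Gamma (real m / 2)"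

definition cauchy_kernel :: "nat \<Rightarrow> 'n::{finite,linorder} paravector \<Rightarrow> 'n clifford" where
  "cauchy_kernel p x = (1 / sphere_area (p + 2)) *\<^sub>R (cl_conj (para x) /\<^sub>R norm x ^ (p + 2))"

text \<open>\<open>\<E>\<^sub>y(x)\<close> and \<open>K\<^sub>y(x)\<close>, for \<open>x\<close> and \<open>y\<close> outside \<^term>\<open>p_space p\<close>.\<close>

definition slice_kernel :: "nat \<Rightarrow> 'n::{finite,linorder} paravector \<Rightarrow> 'n paravector \<Rightarrow> 'n clifford" where
  "slice_kernel p y x =
     (let xp = p_part p x; r = norm (q_part p x); \<omega> = q_dir p x; \<eta> = q_dir p y in
        (1 / 2) *\<^sub>R ((cl_one - para \<omega> \<odot> para \<eta>) \<odot> cauchy_kernel p (y - (xp + r *\<^sub>R \<eta>)))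
      + (1 / 2) *\<^sub>R ((cl_one + para \<omega> \<odot> para \<eta>) \<odot> cauchy_kernel p (y - (xp - r *\<^sub>R \<eta>))))"

definition teodorescu_kernel ::
    "nat \<Rightarrow> nat \<Rightarrow> 'n::{finite,linorder} paravector \<Rightarrow> 'n paravector \<Rightarrow> 'n clifford" where
  "teodorescu_kernel p q y x =
     (1 / (sphere_area q * norm (q_part p y) ^ (q - 1))) *\<^sub>R slice_kernel p y x"

definition teodorescu :: "nat \<Rightarrow> nat \<Rightarrow> 'n::{finite,linorder} paravector set \<Rightarrow>
    ('n paravector \<Rightarrow> 'n clifford) \<Rightarrow> 'n paravector \<Rightarrow> 'n clifford" where
  "teodorescu p q \<Omega> f x = - (\<integral>y. teodorescu_kernel p q y x \<odot> f y \<partial>lebesgue_on \<Omega>)"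

end

theory Submission
  imports Defs
begin

text \<open>
  Write \<open>x = x\<^sub>p + r \<omega>\<close> and \<open>y = y\<^sub>p + \<rho> \<eta>\<close> with \<open>r = |x\<^sub>q|\<close>, \<open>\<rho> = |y\<^sub>q|\<close>.  The two points at which
  the Cauchy kernel enters \<open>K\<^sub>y(x)\<close> lie in the slice \<open>\<real>\<^bsup>p+1\<^esup> \<oplus> \<real>\<eta>\<close> through \<open>y\<close>, so
  \<open>|y - (x\<^sub>p \<plusminus> r \<eta>)|\<^sup>2 = |y\<^sub>p - x\<^sub>p|\<^sup>2 + (\<rho> \<minusplus> r)\<^sup>2\<close>, whence
  \<open>|K\<^sub>y(x)| \<le> C \<rho>\<^bsup>-(q-1)\<^esup> N(x, y)\<close> for a kernel \<open>N\<close> that is symmetric in \<open>x\<close> and \<open>y\<close> and has the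
  singularity \<open>d\<^bsup>-(p+1)\<^esup>\<close> of a distance \<open>d\<close> in \<open>\<real>\<^bsup>p+2\<^esup>\<close>.  On a bounded set this is a weakly singular
  kernel, and the factor \<open>\<rho>\<^bsup>-(q-1)\<^esup>\<close> is handled by a Schur test with weight.  With \<open>1/s + 1/t = 1\<close>, Hoelder's
  inequality splits the integrand as
  \<open>\<rho>\<^bsup>-(q-1)\<^esup> N |f| = (\<rho>\<^bsup>-(q-1)\<^esup> N\<^bsup>1/s\<^esup>) (N\<^bsup>1/t\<^esup> |f|)\<close> and yields
  \<open>|Tf(x)|\<^sup>t \<le> C (\<integral> \<rho>\<^bsup>-(q-1)s\<^esup> N(x, y) dy)\<^bsup>t/s\<^esup> \<integral> N(x, y) |f(y)|\<^sup>t dy\<close>.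

  The exponent \<open>c = (q-1)s = (q-1)t/(t-1)\<close> is smaller than \<open>q\<close> exactly because \<open>t > q\<close>, and for every
  \<open>c < q\<close> the integral \<open>\<integral> \<rho>\<^bsup>-c\<^esup> N(x, y) dy\<close> is bounded uniformly in \<open>x\<close> (\<open>slice_majorant_bound\<close>).  By the
  case \<open>c = 0\<close>, the symmetry of \<open>N\<close> and Tonelli's theorem, integrating over \<open>x\<close> gives
  \<open>\<parallel>Tf\<parallel>\<^sub>t \<le> M \<parallel>f\<parallel>\<^sub>t\<close> (\<open>slice_potential_Lt_bound\<close>), together with the absolute convergence of the integral
  for almost every \<open>x\<close>.

  The uniform bound is reduced to volumes.  Scaling the coordinates of \<open>\<real>\<^bsup>p+1\<^esup>\<close> and of \<open>\<real>\<^sup>q\<close> separately gives the volume of \<open>{|y\<^sub>p - x\<^sub>p| < \<epsilon>, |y\<^sub>q| < s}\<close> up to a constant,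
  and the difference of two such sets controls the shells \<open>{|y\<^sub>p - x\<^sub>p| < \<epsilon>, ||y\<^sub>q| - r| < \<epsilon>}\<close>
  (\<open>emeasure_slice_dist_le\<close>).  A dyadic decomposition (\<open>nn_integral_powr_neg_le\<close>), applied
  once to \<open>\<rho>\<close> and once to \<open>d\<close>, turns these volumes into integrals of negative powers.

  Finally \<open>K\<^sub>y(x) = A\<^sub>y(x\<^sub>p, r) + \<omega> B\<^sub>y(x\<^sub>p, r)\<close> with \<open>A\<^sub>y\<close> even and \<open>B\<^sub>y\<close> odd in \<open>r\<close>, and both parts obey the
  bound for \<open>K\<^sub>y\<close>.  Integrating them against \<open>f\<close> separately produces the stem function of \<open>Tf\<close>
  (\<open>teodorescu_dominated\<close>, \<open>GS_of_even_odd\<close>).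
\<close>


section \<open>Two inequalities for nonnegative integrals\<close>

text \<open>
  Young's inequality is applied to the factors normalised by \<open>A\<^bsup>1/s\<^esup>\<close> and \<open>B\<^bsup>1/t\<^esup>\<close>; this division is why
  the degenerate case, in which one factor vanishes almost everywhere, is treated apart.
\<close>

lemma nn_integral_Holder:
  fixes a b :: "'a \<Rightarrow> real"
  assumes [measurable]: "a \<in> borel_measurable M" "b \<in> borel_measurable M"
    and ab0: "\<And>x. 0 \<le> a x" "\<And>x. 0 \<le> b x"
    and s: "1 < s" and t: "1 < t" and st: "1 / s + 1 / t = 1"
    and A: "(\<integral>\<^sup>+x. ennreal (a x powr s) \<partial>M) \<le> ennreal A" "0 \<le> A"
    and B: "(\<integral>\<^sup>+x. ennreal (b x powr t) \<partial>M) \<le> ennreal B" "0 \<le> B"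
  shows "(\<integral>\<^sup>+x. ennreal (a x * b x) \<partial>M) \<le> ennreal (A powr (1 / s) * B powr (1 / t))"
proof -
  have "AE x in M. a x * b x = 0" if "A = 0 \<or> B = 0"
  proof -
    from that have "(\<integral>\<^sup>+x. ennreal (a x powr s) \<partial>M) = 0 \<or> (\<integral>\<^sup>+x. ennreal (b x powr t) \<partial>M) = 0"
      using A B by auto
    then have "(AE x in M. ennreal (a x powr s) = 0) \<or> (AE x in M. ennreal (b x powr t) = 0)"
      by (subst (asm) (1 2) nn_integral_0_iff_AE) auto
    then show ?thesis
      by (auto elim!: eventually_mono)
  qed
  moreover have ?thesis if "AE x in M. a x * b x = 0"
  proof -
    have "(\<integral>\<^sup>+x. ennreal (a x * b x) \<partial>M) = (\<integral>\<^sup>+x. 0 \<partial>M)"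
      by (rule nn_integral_cong_AE) (use that in auto)
    then show ?thesis by simp
  qed
  moreover have ?thesis if pos: "0 < A" "0 < B"
  proof -
    define \<alpha> where "\<alpha> = A powr (1 / s)"
    define \<beta> where "\<beta> = B powr (1 / t)"
    have \<alpha>: "0 < \<alpha>" "\<alpha> powr s = A" and \<beta>: "0 < \<beta>" "\<beta> powr t = B"
      using pos s t by (simp_all add: \<alpha>_def \<beta>_def powr_powr)
    have young: "a x * b x \<le> \<alpha> * \<beta> / (s * A) * a x powr s + \<alpha> * \<beta> / (t * B) * b x powr t" for x
    proof -
      have "(a x / \<alpha>) * (b x / \<beta>) \<le> (a x / \<alpha>) powr s / s + (b x / \<beta>) powr t / t"
        using ab0 \<alpha> \<beta> s t st by (intro Youngs_inequality) auto
      also have "\<dots> = a x powr s / (s * A) + b x powr t / (t * B)"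
        using ab0 \<alpha> \<beta> by (simp add: powr_divide mult.commute)
      finally have "\<alpha> * \<beta> * ((a x / \<alpha>) * (b x / \<beta>)) \<le> \<alpha> * \<beta> * (a x powr s / (s * A) + b x powr t / (t * B))"
        using \<alpha> \<beta> by (intro mult_left_mono) auto
      then show ?thesis using \<alpha> \<beta> by (simp add: algebra_simps)
    qed
    have "(\<integral>\<^sup>+x. ennreal (a x * b x) \<partial>M)
        \<le> (\<integral>\<^sup>+x. ennreal (\<alpha> * \<beta> / (s * A)) * ennreal (a x powr s) + ennreal (\<alpha> * \<beta> / (t * B)) * ennreal (b x powr t) \<partial>M)"
      using young pos s t \<alpha> \<beta>
      by (intro nn_integral_mono) (simp add: ennreal_mult[symmetric] ennreal_plus[symmetric] del: ennreal_plus)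
    also have "\<dots> = ennreal (\<alpha> * \<beta> / (s * A)) * (\<integral>\<^sup>+x. ennreal (a x powr s) \<partial>M)
        + ennreal (\<alpha> * \<beta> / (t * B)) * (\<integral>\<^sup>+x. ennreal (b x powr t) \<partial>M)"
      by (simp add: nn_integral_add nn_integral_cmult)
    also have "\<dots> \<le> ennreal (\<alpha> * \<beta> / (s * A)) * ennreal A + ennreal (\<alpha> * \<beta> / (t * B)) * ennreal B"
      by (intro add_mono mult_left_mono A B) auto
    also have "\<dots> = ennreal (\<alpha> * \<beta> * (1 / s + 1 / t))"
      using pos s t \<alpha> \<beta> by (simp add: ennreal_mult[symmetric] ennreal_plus[symmetric] algebra_simps del: ennreal_plus)
    finally show ?thesis by (simp add: st \<alpha>_def \<beta>_def)
  qed
  ultimately show ?thesis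
    using A(2) B(2) by fastforce
qed

text \<open>
  On the shell \<open>R 2\<^bsup>-j-1\<^esup> \<le> h < R 2\<^bsup>-j\<^esup>\<close> the function \<open>h\<^bsup>-a\<^esup>\<close> is at most \<open>(R 2\<^bsup>-j-1\<^esup>)\<^bsup>-a\<^esup>\<close>, and the
  weighted measure of the shell is at most \<open>C (R 2\<^bsup>-j\<^esup>)\<^sup>m\<close>; since \<open>a < m\<close> these bounds form a convergent
  geometric series.  The weight \<open>u\<close> allows the lemma to be iterated.  Points with \<open>h = 0\<close> contribute nothing,
  as \<open>0 powr - a = 0\<close>.
\<close>

lemma nn_integral_powr_neg_le:
  fixes h :: "'a \<Rightarrow> real" and u :: "'a \<Rightarrow> ennreal"
  assumes [measurable]: "h \<in> borel_measurable M" "u \<in> borel_measurable M"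
    and h: "\<And>x. x \<in> space M \<Longrightarrow> 0 \<le> h x" "\<And>x. x \<in> space M \<Longrightarrow> h x < R"
    and "a < m" and "0 < R"
    and small: "\<And>\<epsilon>. 0 < \<epsilon> \<Longrightarrow> \<epsilon> \<le> R \<Longrightarrow> (\<integral>\<^sup>+x. u x * indicator {x. h x < \<epsilon>} x \<partial>M) \<le> C * ennreal (\<epsilon> powr m)"
    and "0 \<le> a"
  shows "(\<integral>\<^sup>+x. u x * ennreal (h x powr - a) \<partial>M) \<le> C * ennreal (2 powr a * R powr (m - a) / (1 - 2 powr (a - m)))"
proof -
  define \<epsilon> where "\<epsilon> j = R * (1 / 2) ^ j" for j :: nat
  have \<epsilon>: "0 < \<epsilon> j" "\<epsilon> j \<le> R" "\<epsilon> 0 = R" "\<epsilon> (Suc j) = \<epsilon> j / 2" for j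
    using \<open>0 < R\<close> by (auto simp: \<epsilon>_def power_le_one)
  have dyadic: "u x * ennreal (h x powr - a) \<le> (\<Sum>j. u x * indicator {x. h x < \<epsilon> j} x * ennreal (\<epsilon> (Suc j) powr - a))" (is "_ \<le> suminf ?f")
    if x: "x \<in> space M" for x
  proof (cases "h x = 0")
    case False
    then have pos: "0 < h x" using h(1)[OF x] by simp
    have "(\<lambda>j. R * (1 / 2) ^ j) \<longlonglongrightarrow> R * 0"
      by (intro tendsto_intros LIMSEQ_power_zero) simp
    then have "\<forall>\<^sub>F j in sequentially. R * (1 / 2) ^ j < h x"
      using pos by (intro order_tendstoD(2)[of _ "R * 0"]) auto
    then obtain k where "R * (1 / 2) ^ k < h x"
      unfolding eventually_sequentially by blast
    then have ex: "\<epsilon> k \<le> h x"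
      by (auto simp: \<epsilon>_def)
    \<comment> \<open>If \<open>j = Suc i\<close> is the first index with \<open>\<epsilon> j \<le> h x\<close>, then \<open>h x\<close> lies in the \<open>i\<close>-th shell.\<close>
    define j where "j = (LEAST j. \<epsilon> j \<le> h x)"
    have j: "\<epsilon> j \<le> h x" unfolding j_def using ex by (rule LeastI)
    have "j \<noteq> 0" using j h(2)[OF x] \<epsilon>(3) by (metis not_le)
    then obtain i where i: "j = Suc i" using not0_implies_Suc by blast
    have "\<not> \<epsilon> i \<le> h x"
      using not_less_Least[of i "\<lambda>j. \<epsilon> j \<le> h x"] i by (simp add: j_def)
    then have "h x < \<epsilon> i" by simp
    have "h x powr - a \<le> \<epsilon> (Suc i) powr - a"
      using j i \<epsilon>(1) \<open>0 \<le> a\<close> by (intro powr_mono2') auto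
    then have "u x * ennreal (h x powr - a) \<le> ?f i"
      using \<open>h x < \<epsilon> i\<close> by (auto intro!: mult_left_mono ennreal_leI)
    also have "\<dots> = (\<Sum>j\<in>{i}. ?f j)" by simp
    also have "\<dots> \<le> suminf ?f"
      by (rule sum_le_suminf) auto
    finally show ?thesis .
  qed simp
  have "(\<integral>\<^sup>+x. u x * ennreal (h x powr - a) \<partial>M)
      \<le> (\<integral>\<^sup>+x. (\<Sum>j. u x * indicator {x. h x < \<epsilon> j} x * ennreal (\<epsilon> (Suc j) powr - a)) \<partial>M)"
    by (intro nn_integral_mono dyadic)
  also have "\<dots> = (\<Sum>j. (\<integral>\<^sup>+x. u x * indicator {x. h x < \<epsilon> j} x * ennreal (\<epsilon> (Suc j) powr - a) \<partial>M))"
    by (rule nn_integral_suminf) measurable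
  also have "\<dots> = (\<Sum>j. (\<integral>\<^sup>+x. u x * indicator {x. h x < \<epsilon> j} x \<partial>M) * ennreal (\<epsilon> (Suc j) powr - a))"
    by (subst nn_integral_multc) auto
  also have "\<dots> \<le> (\<Sum>j. C * ennreal (\<epsilon> j powr m) * ennreal (\<epsilon> (Suc j) powr - a))"
    by (intro suminf_le mult_right_mono small \<epsilon>) auto
  also have "\<dots> = (\<Sum>j. C * ennreal (\<epsilon> j powr m * \<epsilon> (Suc j) powr - a))"
    by (simp add: ennreal_mult mult.assoc)
  also have "\<dots> = C * (\<Sum>j. ennreal (\<epsilon> j powr m * \<epsilon> (Suc j) powr - a))"
    by (rule ennreal_suminf_cmult)
  also have "(\<lambda>j. \<epsilon> j powr m * \<epsilon> (Suc j) powr - a) = (\<lambda>j. 2 powr a * R powr (m - a) * (2 powr (a - m)) ^ j)"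
  proof
    fix j
    have "\<epsilon> (Suc j) powr - a = 2 powr a * \<epsilon> j powr - a"
      using \<epsilon>(1)[of j] by (simp add: \<epsilon>(4) powr_divide powr_minus_divide)
    then have "\<epsilon> j powr m * \<epsilon> (Suc j) powr - a = 2 powr a * \<epsilon> j powr (m - a)"
      by (simp add: powr_add[symmetric])
    also have "\<epsilon> j powr (m - a) = R powr (m - a) * (2 powr (a - m)) ^ j"
    proof -
      have "(1 / 2) ^ j = 2 powr - real j"
        by (simp only: powr_minus powr_realpow zero_less_numeral inverse_eq_divide power_one_over)
      then have "((1 / 2) ^ j) powr (m - a) = (2 powr - real j) powr (m - a)"
        by (simp only:)
      also have "\<dots> = 2 powr ((a - m) * real j)"
        unfolding powr_powr by (rule arg_cong[where f = "(powr) 2"]) (simp add: algebra_simps)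
      also have "\<dots> = (2 powr (a - m)) ^ j"
        by (simp only: powr_powr[symmetric] powr_realpow powr_gt_zero)
      finally show ?thesis
        using \<open>0 < R\<close> by (simp add: \<epsilon>_def powr_mult)
    qed
    finally show "\<epsilon> j powr m * \<epsilon> (Suc j) powr - a = 2 powr a * R powr (m - a) * (2 powr (a - m)) ^ j" by simp
  qed
  also have "(\<Sum>j. ennreal (2 powr a * R powr (m - a) * (2 powr (a - m)) ^ j))
      = ennreal (2 powr a * R powr (m - a) / (1 - 2 powr (a - m)))"
  proof (rule suminf_ennreal_eq)
    have "(2::real) powr (a - m) < 2 powr 0"
      using \<open>a < m\<close> by (subst powr_less_cancel_iff) auto
    then have "(\<lambda>j. (2 powr (a - m)) ^ j) sums (1 / (1 - 2 powr (a - m)))"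
      by (intro geometric_sums) simp
    from sums_mult[OF this, of "2 powr a * R powr (m - a)"]
    show "(\<lambda>j. 2 powr a * R powr (m - a) * (2 powr (a - m)) ^ j) sums (2 powr a * R powr (m - a) / (1 - 2 powr (a - m)))"
      by simp
  qed simp
  finally show ?thesis by (simp add: mult.assoc)
qed

section \<open>The splitting of the space of paravectors\<close>

text \<open>
  The rank \<open>j \<mapsto> card {i. i \<le> j}\<close> maps the generators bijectively onto \<open>{1, \<dots>, p + q}\<close>, so exactly \<open>p\<close> of
  them have rank at most \<open>p\<close>.
\<close>

lemma card_p_indices:
  assumes "CARD('n::{finite,linorder}) = p + q"
  shows "card (p_indices p :: 'n option set) = p + 1" "card (- p_indices p :: 'n option set) = q"
proof -
  define rank where "rank j = card {i::'n. i \<le> j}" for j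
  have "inj rank"
  proof (rule linorder_injI)
    fix x y :: 'n assume "x < y"
    then have "{i. i \<le> x} \<subseteq> {i. i \<le> y}" "y \<in> {i. i \<le> y} - {i. i \<le> x}" by auto
    then have "{i. i \<le> x} \<subset> {i. i \<le> y}" by blast
    then have "rank x < rank y" unfolding rank_def by (rule psubset_card_mono[rotated]) simp
    then show "rank x \<noteq> rank y" by simp
  qed
  have "rank j \<in> {1..p+q}" for j
  proof -
    have "0 < rank j" unfolding rank_def by (subst card_gt_0_iff) auto
    moreover have "rank j \<le> CARD('n)" unfolding rank_def by (rule card_mono) auto
    ultimately show ?thesis using assms by simp
  qed
  then have "range rank = {1..p+q}"
    using assms card_image[OF \<open>inj rank\<close>] by (intro card_subset_eq) auto
  then have "rank ` {j. rank j \<le> p} = {1..p}"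
    by (auto simp: image_iff set_eq_iff) (metis le_add1 le_trans)
  then have "card {j. rank j \<le> p} = p"
    using card_image[of rank "{j. rank j \<le> p}"] \<open>inj rank\<close> by (simp add: inj_on_def)
  then have *: "card (Some ` {j::'n. card {i. i \<le> j} \<le> p}) = p"
    by (simp add: card_image rank_def)
  then show "card (p_indices p :: 'n option set) = p + 1"
    unfolding p_indices_def by (subst card_insert_disjoint) auto
  then show "card (- p_indices p :: 'n option set) = q"
    using assms by (simp add: Compl_eq_Diff_UNIV card_Diff_subset)
qed

lemma linear_p_part: "linear (p_part p)" and linear_q_part: "linear (q_part p)"
  by (auto intro!: linearI simp: p_part_def q_part_def vec_eq_iff)

lemma p_part_plus_q_part: "p_part p x + q_part p x = x"
  by (simp add: p_part_def q_part_def vec_eq_iff)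

lemma p_part_p_part [simp]: "p_part p (p_part p x) = p_part p x"
  and q_part_q_part [simp]: "q_part p (q_part p x) = q_part p x"
  and p_part_q_part [simp]: "p_part p (q_part p x) = 0"
  and q_part_p_part [simp]: "q_part p (p_part p x) = 0"
  by (auto simp: p_part_def q_part_def vec_eq_iff)

lemma norm_p_part_q_part: "(norm x)\<^sup>2 = (norm (p_part p x))\<^sup>2 + (norm (q_part p x))\<^sup>2"
proof -
  have "p_part p x \<bullet> q_part p x = 0"
    by (auto simp: inner_vec_def p_part_def q_part_def intro!: sum.neutral)
  then have "orthogonal (p_part p x) (q_part p x)" by (simp add: orthogonal_def)
  from norm_add_Pythagorean[OF this] show ?thesis by (simp add: p_part_plus_q_part)
qed

lemmas linear_part_simps [simp] =
  linear_add[OF linear_p_part] linear_diff[OF linear_p_part] linear_scale[OF linear_p_part] linear_0[OF linear_p_part]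
  linear_add[OF linear_q_part] linear_diff[OF linear_q_part] linear_scale[OF linear_q_part] linear_0[OF linear_q_part]

lemma continuous_on_p_part [continuous_intros]: "continuous_on S f \<Longrightarrow> continuous_on S (\<lambda>x. p_part p (f x))"
  by (rule bounded_linear.continuous_on[OF linear_p_part[unfolded linear_conv_bounded_linear]])

lemma continuous_on_q_part [continuous_intros]: "continuous_on S f \<Longrightarrow> continuous_on S (\<lambda>x. q_part p (f x))"
  by (rule bounded_linear.continuous_on[OF linear_q_part[unfolded linear_conv_bounded_linear]])

lemma borel_measurable_p_part [measurable]: "p_part p \<in> borel_measurable borel"
  by (rule borel_measurable_continuous_onI, rule continuous_on_p_part, rule continuous_on_id)

lemma borel_measurable_q_part [measurable]: "q_part p \<in> borel_measurable borel"
  by (rule borel_measurable_continuous_onI, rule continuous_on_q_part, rule continuous_on_id)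

lemma axis_nth_if: "axis i x $ j = (if j = i then x else 0)"
  by (simp add: axis_def)

section \<open>Volumes near a slice\<close>

definition product_cyl :: "nat \<Rightarrow> 'n::{finite,linorder} paravector \<Rightarrow> real \<Rightarrow> real \<Rightarrow> 'n paravector set" where
  "product_cyl p x \<epsilon> s = {y. norm (p_part p (y - x)) < \<epsilon> \<and> norm (q_part p y) < s}"

lemma product_cyl_borel [measurable]: "product_cyl p x \<epsilon> s \<in> sets borel"
  unfolding product_cyl_def by measurable

text \<open>
  The set is the image of the unit cylinder under the affine map that scales the first \<open>p + 1\<close> coordinates by
  \<open>\<epsilon>\<close> and the other \<open>q\<close> coordinates by \<open>s\<close>, whose determinant is \<open>\<epsilon>\<^bsup>p+1\<^esup> s\<^sup>q\<close>.
\<close>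

lemma emeasure_product_cyl:
  fixes x :: "'n::{finite,linorder} paravector"
  assumes "CARD('n) = p + q" "0 < \<epsilon>" "0 < s"
  shows "emeasure lborel (product_cyl p x \<epsilon> s)
    = ennreal (\<epsilon> ^ (p + 1) * s ^ q) * emeasure lborel (product_cyl p (0::'n paravector) 1 1)"
proof -
  define c where "c j = (if j \<in> (\<lambda>i. axis i (1::real)) ` p_indices p then \<epsilon> else s)" for j :: "'n paravector"
  define T where "T y = p_part p x + (\<Sum>j\<in>Basis. (c j * (y \<bullet> j)) *\<^sub>R j)" for y
  have B: "Basis = (\<lambda>i. axis i 1 :: 'n paravector) ` UNIV"
    by (auto simp: Basis_vec_def)
  have inj: "inj (\<lambda>i. axis i 1 :: 'n paravector)"
    by (auto simp: inj_on_def axis_eq_axis)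
  have c: "c (axis i 1) = (if i \<in> p_indices p then \<epsilon> else s)" for i
    using inj by (auto simp: c_def inj_on_def)
  have Tsum: "(\<Sum>j\<in>Basis. (c j * (y \<bullet> j)) *\<^sub>R j) = \<epsilon> *\<^sub>R p_part p y + s *\<^sub>R q_part p y" for y
  proof (rule vec_eq_iff[THEN iffD2], rule allI)
    fix k
    have "(\<Sum>j\<in>Basis. (c j * (y \<bullet> j)) *\<^sub>R j) $ k
        = (\<Sum>i\<in>UNIV. if k = i then (if i \<in> p_indices p then \<epsilon> else s) * y $ i else 0)"
      unfolding B sum.reindex[OF inj] o_def c sum_component vector_scaleR_component axis_nth_if inner_axis
      by (intro sum.cong) auto
    also have "\<dots> = (\<epsilon> *\<^sub>R p_part p y + s *\<^sub>R q_part p y) $ k"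
      by (simp add: p_part_def q_part_def)
    finally show "(\<Sum>j\<in>Basis. (c j * (y \<bullet> j)) *\<^sub>R j) $ k = (\<epsilon> *\<^sub>R p_part p y + s *\<^sub>R q_part p y) $ k" .
  qed
  have T: "T y = p_part p x + \<epsilon> *\<^sub>R p_part p y + s *\<^sub>R q_part p y" for y
    by (simp add: T_def Tsum add.assoc)
  have [measurable]: "T \<in> borel_measurable borel"
    unfolding T[abs_def] by measurable
  have "(\<Prod>j\<in>Basis. \<bar>c j\<bar>) = (\<Prod>i\<in>(UNIV::'n option set). if i \<in> p_indices p then \<epsilon> else s)"
    unfolding B prod.reindex[OF inj] o_def c by (rule prod.cong[OF refl]) (use assms in auto)
  also have "\<dots> = \<epsilon> ^ (p + 1) * s ^ q"
    using card_p_indices[OF assms(1)] by (simp add: prod.If_cases)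
  finally have prod: "(\<Prod>j\<in>Basis. \<bar>c j\<bar>) = \<epsilon> ^ (p + 1) * s ^ q" .
  have pre: "T -` product_cyl p x \<epsilon> s = product_cyl p 0 1 1"
    using assms by (auto simp: product_cyl_def T mult_less_cancel_left1)
  have "lborel = density (distr lborel borel T) (\<lambda>_. ennreal (\<epsilon> ^ (p + 1) * s ^ q))"
    unfolding prod[symmetric] T_def[abs_def]
    by (rule lborel_affine_euclidean) (use assms in \<open>auto simp: c_def\<close>)
  then have "emeasure lborel (product_cyl p x \<epsilon> s)
      = emeasure (density (distr lborel borel T) (\<lambda>_. ennreal (\<epsilon> ^ (p + 1) * s ^ q))) (product_cyl p x \<epsilon> s)"
    by simp
  also have "\<dots> = ennreal (\<epsilon> ^ (p + 1) * s ^ q) * emeasure lborel (product_cyl p (0::'n paravector) 1 1)"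
    by (simp add: emeasure_density nn_integral_cmult_indicator emeasure_distr pre)
  finally show ?thesis .
qed

lemma emeasure_product_cyl_finite: "emeasure lborel (product_cyl p x \<epsilon> s) < \<infinity>"
proof -
  have "product_cyl p x \<epsilon> s \<subseteq> cball (p_part p x) (\<epsilon> + s)"
  proof
    fix y assume "y \<in> product_cyl p x \<epsilon> s"
    then have "norm (p_part p (y - x) + q_part p y) \<le> \<epsilon> + s"
      by (intro norm_triangle_le) (auto simp: product_cyl_def)
    moreover have "p_part p (y - x) + q_part p y = y - p_part p x"
      using p_part_plus_q_part[of p y] by (simp add: algebra_simps)
    ultimately have "norm (y - p_part p x) \<le> \<epsilon> + s" by (simp only:)
    then show "y \<in> cball (p_part p x) (\<epsilon> + s)"
      by (simp add: dist_norm norm_minus_commute)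
  qed
  then have "emeasure lborel (product_cyl p x \<epsilon> s) \<le> emeasure lborel (cball (p_part p x) (\<epsilon> + s))"
    by (rule emeasure_mono) auto
  also have "\<dots> < \<infinity>" by (rule emeasure_lborel_cball_finite)
  finally show ?thesis .
qed

text \<open>
  The distance of \<open>y = y\<^sub>p + \<rho> \<eta>\<close> to \<open>x\<^sub>p + r \<eta>\<close>, as \<open>norm_slice_diff\<close> shows.  The parameter \<open>r\<close> is kept
  apart from \<open>x\<close> and may be negative, so that both arguments of the Cauchy kernel are covered.
\<close>

definition slice_dist :: "nat \<Rightarrow> 'n::{finite,linorder} paravector \<Rightarrow> real \<Rightarrow> 'n paravector \<Rightarrow> real" where
  "slice_dist p x r y = sqrt ((norm (p_part p (y - x)))\<^sup>2 + (norm (q_part p y) - r)\<^sup>2)"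

lemma slice_dist_nonneg [simp]: "0 \<le> slice_dist p x r y"
  by (simp add: slice_dist_def)

lemma slice_dist_ge: "norm (p_part p (y - x)) \<le> slice_dist p x r y" "\<bar>norm (q_part p y) - r\<bar> \<le> slice_dist p x r y"
  unfolding slice_dist_def by (auto intro!: real_le_rsqrt)

lemma measure_product_cyl:
  fixes x :: "'n::{finite,linorder} paravector"
  assumes "CARD('n) = p + q" "1 \<le> q" "0 < \<epsilon>" "0 \<le> s"
  shows "measure lborel (product_cyl p x \<epsilon> s)
    = \<epsilon> ^ (p + 1) * s ^ q * measure lborel (product_cyl p (0::'n paravector) 1 1)"
proof (cases "s = 0")
  case True
  then have "product_cyl p x \<epsilon> s = {}" by (auto simp: product_cyl_def)
  then show ?thesis using True assms by simp
next
  case False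
  then have "emeasure lborel (product_cyl p x \<epsilon> s)
    = ennreal (\<epsilon> ^ (p + 1) * s ^ q) * emeasure lborel (product_cyl p (0::'n paravector) 1 1)"
    using assms by (intro emeasure_product_cyl) auto
  then show ?thesis
    using assms by (simp add: measure_def enn2real_mult)
qed

lemma power_diff_le:
  fixes a b :: real
  assumes "0 \<le> a" "a \<le> b" "b \<le> R"
  shows "b ^ q - a ^ q \<le> real q * R ^ (q - 1) * (b - a)"
proof -
  have "b ^ q - a ^ q = (b - a) * (\<Sum>i<q. a ^ (q - Suc i) * b ^ i)"
    by (rule power_diff_sumr2)
  also have "\<dots> \<le> (b - a) * (\<Sum>i<q. R ^ (q - 1))"
  proof (intro mult_left_mono sum_mono)
    fix i assume "i \<in> {..<q}"
    then have e: "(q - Suc i) + i = q - 1" by auto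
    have "a ^ (q - Suc i) * b ^ i \<le> R ^ (q - Suc i) * R ^ i"
      using assms by (intro mult_mono power_mono) auto
    then show "a ^ (q - Suc i) * b ^ i \<le> R ^ (q - 1)"
      by (simp add: power_add[symmetric] e)
  qed (use assms in auto)
  finally show ?thesis by (simp add: algebra_simps)
qed

text \<open>
  The bound by \<open>s\<^sup>q\<close> comes from \<open>|y\<^sub>q| < s\<close> alone.  The bound by \<open>\<epsilon>\<close> comes from \<open>|y\<^sub>q|\<close> being confined to an
  interval of length at most \<open>2 \<epsilon>\<close> inside \<open>[0, R]\<close>: the set lies in the difference of two cylinders.
\<close>

lemma emeasure_slice_dist_le:
  fixes x :: "'n::{finite,linorder} paravector"
  assumes n: "CARD('n) = p + q" "1 \<le> q" and R: "0 < \<epsilon>" "0 < s" "s \<le> R"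
  defines "V \<equiv> measure lborel (product_cyl p (0::'n paravector) 1 1)"
  shows "emeasure lborel {y. slice_dist p x r y < \<epsilon> \<and> norm (q_part p y) < s}
    \<le> ennreal (V * (1 + 2 * real q * R ^ (q - 1)) * \<epsilon> ^ (p + 1) * min (s ^ q) \<epsilon>)"
proof -
  define S where "S = {y. slice_dist p x r y < \<epsilon> \<and> norm (q_part p y) < s}"
  define a where "a = max 0 (r - \<epsilon>)"
  define b where "b = max a (min (r + \<epsilon>) s)"
  have V: "0 \<le> V" by (simp add: V_def)
  let ?c = "product_cyl p x \<epsilon>"
  have fin: "?c u \<in> fmeasurable lborel" for u
    using emeasure_product_cyl_finite by (intro fmeasurableI) auto
  have "S \<subseteq> ?c s" using order.strict_trans1[OF slice_dist_ge(1)] by (auto simp: S_def product_cyl_def)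
  then have "emeasure lborel S \<le> emeasure lborel (?c s)" by (rule emeasure_mono) auto
  then have 1: "emeasure lborel S \<le> ennreal (V * \<epsilon> ^ (p + 1) * s ^ q)"
    using measure_product_cyl[OF n R(1), of s x] R
    by (simp add: emeasure_eq_measure2[OF fin] V_def mult_ac)
  have "S \<subseteq> ?c b - ?c a"
  proof
    fix y assume y: "y \<in> S"
    then have "norm (p_part p (y - x)) < \<epsilon>" "\<bar>norm (q_part p y) - r\<bar> < \<epsilon>" "norm (q_part p y) < s"
      using order.strict_trans1[OF slice_dist_ge(1)] order.strict_trans1[OF slice_dist_ge(2)]
      by (auto simp: S_def)
    then show "y \<in> ?c b - ?c a"
      unfolding product_cyl_def a_def b_def
      using norm_ge_zero[of "q_part p y"] by (auto simp: abs_less_iff max_def min_def simp del: norm_ge_zero)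
  qed
  then have "emeasure lborel S \<le> emeasure lborel (?c b - ?c a)" by (rule emeasure_mono) auto
  also have "\<dots> = ennreal (measure lborel (?c b) - measure lborel (?c a))"
  proof -
    have "?c a \<subseteq> ?c b" by (auto simp: product_cyl_def b_def)
    then show ?thesis
      using fin[of a] fin[of b] by (simp add: emeasure_eq_measure2 fmeasurable.Diff measure_Diff fmeasurableD2)
  qed
  also have "measure lborel (?c b) - measure lborel (?c a) = V * \<epsilon> ^ (p + 1) * (b ^ q - a ^ q)"
    unfolding V_def using n R by (subst (1 2) measure_product_cyl[where q=q]) (auto simp: a_def b_def algebra_simps)
  also have "\<dots> \<le> V * \<epsilon> ^ (p + 1) * (2 * real q * R ^ (q - 1) * \<epsilon>)"
  proof (intro mult_left_mono)
    show "b ^ q - a ^ q \<le> 2 * real q * R ^ (q - 1) * \<epsilon>"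
    proof (cases "a < b")
      case True
      have "b ^ q - a ^ q \<le> real q * R ^ (q - 1) * (b - a)"
        using True R by (intro power_diff_le) (auto simp: a_def b_def)
      also have "\<dots> \<le> real q * R ^ (q - 1) * (2 * \<epsilon>)"
        using True R by (intro mult_left_mono) (auto simp: a_def b_def)
      finally show ?thesis by (simp add: algebra_simps)
    next
      case False
      then have "b = a" by (simp add: b_def)
      then show ?thesis using R by simp
    qed
  qed (use V R in auto)
  finally have 2: "emeasure lborel S \<le> ennreal (V * \<epsilon> ^ (p + 1) * (2 * real q * R ^ (q - 1) * \<epsilon>))"
    by (auto intro: ennreal_leI)
  have *: "V * \<epsilon> ^ (p + 1) * s ^ q \<le> V * (1 + 2 * real q * R ^ (q - 1)) * \<epsilon> ^ (p + 1) * s ^ q"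
    and **: "V * \<epsilon> ^ (p + 1) * (2 * real q * R ^ (q - 1) * \<epsilon>) \<le> V * (1 + 2 * real q * R ^ (q - 1)) * \<epsilon> ^ (p + 1) * \<epsilon>"
    using V R by (simp_all add: algebra_simps)
  have "emeasure lborel S \<le> ennreal (V * (1 + 2 * real q * R ^ (q - 1)) * \<epsilon> ^ (p + 1) * min (s ^ q) \<epsilon>)"
    using order.trans[OF 1 ennreal_leI[OF *]] order.trans[OF 2 ennreal_leI[OF **]]
    by (simp add: min_def)
  then show ?thesis by (simp add: S_def)
qed

text \<open>
  Interpolation between the two bounds of \<open>emeasure_slice_dist_le\<close> separates the variables \<open>s\<close> and \<open>\<epsilon>\<close>.
\<close>

lemma min_le_powr_powr:
  fixes a b :: real
  assumes "0 < a" "0 < b" "0 \<le> \<theta>" "\<theta> \<le> 1"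
  shows "min a b \<le> a powr \<theta> * b powr (1 - \<theta>)"
proof -
  have "min a b = min a b powr \<theta> * min a b powr (1 - \<theta>)"
    using assms by (simp add: powr_add[symmetric])
  also have "\<dots> \<le> a powr \<theta> * b powr (1 - \<theta>)"
    using assms by (intro mult_mono powr_mono2) auto
  finally show ?thesis .
qed

lemma slice_dist_measurable [measurable]: "slice_dist p x r \<in> borel_measurable borel"
  unfolding slice_dist_def[abs_def] by measurable

lemma
  assumes \<Omega>: "\<Omega> \<in> sets lebesgue" and B: "B \<in> sets borel"
  shows sets_lebesgue_on_Int: "B \<inter> \<Omega> \<in> sets (lebesgue_on \<Omega>)"
    and emeasure_lebesgue_on_Int_le: "emeasure (lebesgue_on \<Omega>) (B \<inter> \<Omega>) \<le> emeasure lborel B"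
proof -
  have B': "B \<in> sets lebesgue"
    by (rule sets_completionI_sets) (simp only: sets_lborel B)
  then have "B \<inter> \<Omega> \<in> sets lebesgue" using \<Omega> by (rule sets.Int)
  then show "B \<inter> \<Omega> \<in> sets (lebesgue_on \<Omega>)"
    using \<Omega> by (subst sets_restrict_space_iff) auto
  have "emeasure (lebesgue_on \<Omega>) (B \<inter> \<Omega>) = emeasure lebesgue (B \<inter> \<Omega>)"
    using \<Omega> by (subst emeasure_restrict_space) auto
  also have "\<dots> \<le> emeasure lebesgue B"
    by (rule emeasure_mono[OF _ B']) auto
  finally show "emeasure (lebesgue_on \<Omega>) (B \<inter> \<Omega>) \<le> emeasure lborel B"
    using B by simp
qed

text \<open>
  Interpolated with an exponent \<open>\<theta>\<close>, the volume of \<open>{d < \<epsilon>, |y\<^sub>q| < s}\<close> is \<open>O(s\<^bsup>q\<theta>\<^esup> \<epsilon>\<^bsup>p+2-\<theta>\<^esup>)\<close>.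
  Summing dyadically in \<open>s\<close> needs \<open>c < q \<theta>\<close>, and summing in \<open>\<epsilon>\<close> needs \<open>p + 1 < p + 2 - \<theta>\<close>, that is
  \<open>\<theta> < 1\<close>; both are possible because \<open>c < q\<close>.
\<close>

lemma weighted_slice_kernel_bound:
  fixes \<Omega> :: "'n::{finite,linorder} paravector set"
  assumes n: "CARD('n) = p + q" "1 \<le> q" and c: "0 \<le> c" "c < real q"
    and \<Omega>: "\<Omega> \<in> sets lebesgue" "\<And>y. y \<in> \<Omega> \<Longrightarrow> norm y \<le> L" and "0 < L"
  obtains A where "0 \<le> A" "\<And>x r. x \<in> \<Omega> \<Longrightarrow> \<bar>r\<bar> \<le> L \<Longrightarrow>
    (\<integral>\<^sup>+y. ennreal (norm (q_part p y) powr - c * slice_dist p x r y powr - (real p + 1)) \<partial>lebesgue_on \<Omega>) \<le> ennreal A"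
proof -
  \<comment> \<open>On \<open>\<Omega>\<close> both \<open>|y\<^sub>q| \<le> L\<close> and \<open>d \<le> 4 L\<close>; the dyadic lemma asks for a strict bound.\<close>
  define R where "R = 5 * L"
  have "0 < R" using \<open>0 < L\<close> by (simp add: R_def)
  \<comment> \<open>the midpoint of the admissible interval \<open>c / q < \<theta> < 1\<close>\<close>
  define \<theta> where "\<theta> = (c / real q + 1) / 2"
  have \<theta>: "0 \<le> \<theta>" "\<theta> < 1" "c < real q * \<theta>"
    using c n by (auto simp: \<theta>_def field_simps)
  define V where "V = measure lborel (product_cyl p (0::'n paravector) 1 1) * (1 + 2 * real q * R ^ (q - 1))"
  have "0 \<le> V" using \<open>0 < R\<close> by (simp add: V_def)
  define K where "K a m = 2 powr a * R powr (m - a) / (1 - 2 powr (a - m))" for a m :: real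
  have K: "0 \<le> K a m" if "a < m" for a m
  proof -
    have "(2::real) powr (a - m) \<le> 2 powr 0"
      using that by (subst powr_le_cancel_iff) auto
    then show ?thesis by (simp add: K_def)
  qed
  have meas: "f \<in> borel_measurable (lebesgue_on \<Omega>)" if "f \<in> borel_measurable borel" for f :: "'n paravector \<Rightarrow> real"
    using that by (intro measurable_restrict_space1) (simp add: measurable_completion)
  have [measurable]: "slice_dist p x r \<in> borel_measurable (lebesgue_on \<Omega>)" for x r
    by (rule meas) measurable
  have [measurable]: "(\<lambda>y. norm (q_part p y)) \<in> borel_measurable (lebesgue_on \<Omega>)"
    by (rule meas) measurable
  define \<Phi> where "\<Phi> x r = (\<integral>\<^sup>+y. ennreal (norm (q_part p y) powr - c) * ennreal (slice_dist p x r y powr - (real p + 1)) \<partial>lebesgue_on \<Omega>)" for x r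
  have q_lt: "norm (q_part p y) < R" if "y \<in> \<Omega>" for y
  proof -
    have "(norm (q_part p y))\<^sup>2 \<le> (norm y)\<^sup>2" by (simp add: norm_p_part_q_part[of y p])
    then have "norm (q_part p y) \<le> norm y" by simp
    with \<Omega>(2)[OF that] \<open>0 < L\<close> show ?thesis by (simp add: R_def)
  qed
  have main: "\<Phi> x r \<le> ennreal (V * K c (real q * \<theta>) * K (real p + 1) (real p + 2 - \<theta>))"
    if x: "x \<in> \<Omega>" and r: "\<bar>r\<bar> \<le> L" for x r
  proof -
    have d_lt: "slice_dist p x r y < R" if "y \<in> \<Omega>" for y
    proof -
      have p: "norm (p_part p (y - x)) \<le> norm (y - x)"
        by (rule power2_le_imp_le) (simp_all add: norm_p_part_q_part[of "y - x" p])
      have q: "norm (q_part p y) \<le> norm y"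
        by (rule power2_le_imp_le) (simp_all add: norm_p_part_q_part[of y p])
      have "slice_dist p x r y \<le> norm (p_part p (y - x)) + \<bar>norm (q_part p y) - r\<bar>"
        unfolding slice_dist_def by (rule order.trans[OF sqrt_add_le_add_sqrt]) auto
      also have "\<dots> \<le> (norm y + norm x) + (norm y + \<bar>r\<bar>)"
        using p q norm_triangle_ineq4[of y x] norm_ge_zero[of "q_part p y"] by linarith
      also have "\<dots> < R"
        using \<Omega>(2)[OF that] \<Omega>(2)[OF x] r \<open>0 < L\<close> by (simp add: R_def)
      finally show ?thesis .
    qed
    have inner: "(\<integral>\<^sup>+y. ennreal (norm (q_part p y) powr - c) * indicator {y. slice_dist p x r y < \<epsilon>} y \<partial>lebesgue_on \<Omega>)
        \<le> ennreal (V * K c (real q * \<theta>)) * ennreal (\<epsilon> powr (real p + 2 - \<theta>))" if \<epsilon>: "0 < \<epsilon>" for \<epsilon>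
    proof -
      have "(\<integral>\<^sup>+y. indicator {y. slice_dist p x r y < \<epsilon>} y * ennreal (norm (q_part p y) powr - c) \<partial>lebesgue_on \<Omega>)
        \<le> ennreal (V * \<epsilon> powr (real p + 2 - \<theta>)) * ennreal (2 powr c * R powr (real q * \<theta> - c) / (1 - 2 powr (c - real q * \<theta>)))"
      proof (rule nn_integral_powr_neg_le)
        fix s assume s: "0 < s" "s \<le> R"
        have "(\<integral>\<^sup>+y. indicator {y. slice_dist p x r y < \<epsilon>} y * indicator {y. norm (q_part p y) < s} y \<partial>lebesgue_on \<Omega>)
            = (\<integral>\<^sup>+y. indicator ({y. slice_dist p x r y < \<epsilon> \<and> norm (q_part p y) < s} \<inter> \<Omega>) y \<partial>lebesgue_on \<Omega>)"
          by (rule nn_integral_cong) (auto split: split_indicator)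
        also have "\<dots> = emeasure (lebesgue_on \<Omega>) ({y. slice_dist p x r y < \<epsilon> \<and> norm (q_part p y) < s} \<inter> \<Omega>)"
          by (rule nn_integral_indicator, rule sets_lebesgue_on_Int[OF \<Omega>(1)]) measurable
        also have "\<dots> \<le> emeasure lborel {y. slice_dist p x r y < \<epsilon> \<and> norm (q_part p y) < s}"
          by (rule emeasure_lebesgue_on_Int_le[OF \<Omega>(1)]) measurable
        also have "\<dots> \<le> ennreal (V * \<epsilon> ^ (p + 1) * min (s ^ q) \<epsilon>)"
          unfolding V_def by (rule emeasure_slice_dist_le) (use n \<epsilon> s in auto)
        also have "\<dots> \<le> ennreal (V * \<epsilon> ^ (p + 1) * ((s ^ q) powr \<theta> * \<epsilon> powr (1 - \<theta>)))"
          using \<open>0 \<le> V\<close> \<epsilon> s \<theta> by (intro ennreal_leI mult_left_mono min_le_powr_powr) auto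
        also have "V * \<epsilon> ^ (p + 1) * ((s ^ q) powr \<theta> * \<epsilon> powr (1 - \<theta>)) = V * \<epsilon> powr (real p + 2 - \<theta>) * s powr (real q * \<theta>)"
        proof -
          have "\<epsilon> ^ (p + 1) * \<epsilon> powr (1 - \<theta>) = \<epsilon> powr (real p + 2 - \<theta>)"
            using \<epsilon> by (simp add: powr_realpow[symmetric] powr_add[symmetric] algebra_simps del: power_Suc)
          moreover have "(s ^ q) powr \<theta> = s powr (real q * \<theta>)"
            using s by (simp add: powr_realpow[symmetric] powr_powr)
          ultimately show ?thesis by (simp add: mult_ac)
        qed
        finally show "(\<integral>\<^sup>+y. indicator {y. slice_dist p x r y < \<epsilon>} y * indicator {y. norm (q_part p y) < s} y \<partial>lebesgue_on \<Omega>)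
            \<le> ennreal (V * \<epsilon> powr (real p + 2 - \<theta>)) * ennreal (s powr (real q * \<theta>))"
          using \<open>0 \<le> V\<close> by (simp add: ennreal_mult)
      next
        show "indicator {y. slice_dist p x r y < \<epsilon>} \<in> borel_measurable (lebesgue_on \<Omega>)"
          by (rule measurable_restrict_space1, rule measurable_completion) measurable
      qed (use q_lt c \<theta> \<open>0 < R\<close> in auto)
      then show ?thesis
        using \<open>0 \<le> V\<close> K[OF \<theta>(3)] unfolding K_def[symmetric] by (simp add: ennreal_mult mult_ac)
    qed
    have "\<Phi> x r \<le> ennreal (V * K c (real q * \<theta>)) *
        ennreal (2 powr (real p + 1) * R powr (real p + 2 - \<theta> - (real p + 1)) / (1 - 2 powr (real p + 1 - (real p + 2 - \<theta>))))"
      unfolding \<Phi>_def using inner by (intro nn_integral_powr_neg_le) (use d_lt \<theta> \<open>0 < R\<close> in auto)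
    also have "\<dots> = ennreal (V * K c (real q * \<theta>) * K (real p + 1) (real p + 2 - \<theta>))"
      using \<open>0 \<le> V\<close> K[OF \<theta>(3)] K[of "real p + 1" "real p + 2 - \<theta>"] \<theta> unfolding K_def[symmetric] by (simp add: ennreal_mult)
    finally show ?thesis .
  qed
  have "0 \<le> V * K c (real q * \<theta>) * K (real p + 1) (real p + 2 - \<theta>)"
    using \<open>0 \<le> V\<close> K[OF \<theta>(3)] K[of "real p + 1" "real p + 2 - \<theta>"] \<theta> by simp
  then show thesis
    by (rule that) (use main in \<open>simp add: \<Phi>_def ennreal_mult\<close>)
qed

section \<open>The Clifford product; parity and size of the kernel\<close>

lemma bilinear_cl_mult: "bilinear (cl_mult :: 'n::{finite,linorder} clifford \<Rightarrow> _)"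
  unfolding bilinear_def
  by (intro conjI allI linearI)
    (simp_all add: vec_eq_iff cl_mult_nth sum.distrib[symmetric] sum_distrib_left algebra_simps)

lemma bounded_bilinear_cl_mult: "bounded_bilinear (cl_mult :: 'n::{finite,linorder} clifford \<Rightarrow> _)"
  using bilinear_cl_mult by (simp add: bilinear_conv_bounded_bilinear)

interpretation cl_mult: bounded_bilinear "cl_mult :: 'n::{finite,linorder} clifford \<Rightarrow> _"
  by (rule bounded_bilinear_cl_mult)

lemma bounded_linear_para: "bounded_linear (para :: 'n::{finite,linorder} paravector \<Rightarrow> _)"
  unfolding para_def[abs_def] linear_conv_bounded_linear[symmetric]
  by (intro linearI) (simp_all add: sum.distrib[symmetric] scaleR_sum_right scaleR_add_left)

lemma bounded_linear_cl_conj: "bounded_linear (cl_conj :: 'n::{finite,linorder} clifford \<Rightarrow> _)"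
  unfolding cl_conj_def[abs_def] linear_conv_bounded_linear[symmetric]
  by (intro linearI) (simp_all add: vec_eq_iff algebra_simps)

text \<open>
  In the double sum for the square, symmetrising in the two indices leaves only the diagonal, by the relation
  \<open>e\<^sub>i e\<^sub>j + e\<^sub>j e\<^sub>i = - 2 \<delta>\<^sub>i\<^sub>j\<close>.
\<close>

lemma para_square:
  fixes \<omega> :: "'n::{finite,linorder} paravector"
  assumes "\<omega> \<in> q_space p"
  shows "para \<omega> \<odot> para \<omega> = - ((norm \<omega>)\<^sup>2 *\<^sub>R cl_one)"
proof -
  let ?e = "\<lambda>i. cl_unit i :: 'n clifford"
  have None: "\<omega> $ None = 0"
    using assms by (simp add: q_space_def p_part_def vec_eq_iff p_indices_def) (metis insertI1)
  have 1: "para \<omega> \<odot> para \<omega> = (\<Sum>i\<in>UNIV. \<Sum>j\<in>UNIV. (\<omega> $ i * \<omega> $ j) *\<^sub>R (?e j \<odot> ?e i))"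
    by (simp add: para_def cl_mult.sum_left cl_mult.sum_right cl_mult.scaleR_left cl_mult.scaleR_right scaleR_sum_right)
  then have 2: "para \<omega> \<odot> para \<omega> = (\<Sum>i\<in>UNIV. \<Sum>j\<in>UNIV. (\<omega> $ i * \<omega> $ j) *\<^sub>R (?e i \<odot> ?e j))"
    by (subst sum.swap) (simp add: mult.commute)
  have "2 *\<^sub>R (para \<omega> \<odot> para \<omega>)
      = (\<Sum>i\<in>UNIV. \<Sum>j\<in>UNIV. (\<omega> $ i * \<omega> $ j) *\<^sub>R (?e i \<odot> ?e j + ?e j \<odot> ?e i))"
    unfolding scaleR_2 scaleR_add_right sum.distrib using 1 2 by metis
  also have "\<dots> = (\<Sum>i\<in>UNIV. \<Sum>j\<in>UNIV. if i = j then - (2 * (\<omega> $ i)\<^sup>2) *\<^sub>R cl_one else 0)"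
  proof (intro sum.cong refl)
    fix i j :: "'n option"
    show "(\<omega> $ i * \<omega> $ j) *\<^sub>R (?e i \<odot> ?e j + ?e j \<odot> ?e i) = (if i = j then - (2 * (\<omega> $ i)\<^sup>2) *\<^sub>R cl_one else 0)"
    proof (cases "i = None \<or> j = None")
      case True
      then show ?thesis using None by auto
    next
      case False
      then obtain k l where "i = Some k" "j = Some l" by auto
      then show ?thesis by (auto simp: cl_generator_relation power2_eq_square)
    qed
  qed
  also have "\<dots> = (- 2 * (\<Sum>i\<in>UNIV. (\<omega> $ i)\<^sup>2)) *\<^sub>R cl_one"
    by (simp add: scaleR_sum_left[symmetric] sum_negf sum_distrib_left)
  also have "(\<Sum>i\<in>UNIV. (\<omega> $ i)\<^sup>2) = (norm \<omega>)\<^sup>2"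
    by (simp add: norm_vec_def L2_set_def sum_nonneg)
  finally have "2 *\<^sub>R (para \<omega> \<odot> para \<omega>) = 2 *\<^sub>R (- ((norm \<omega>)\<^sup>2 *\<^sub>R cl_one))" by simp
  then show ?thesis by (simp only: scaleR_cancel_left) simp
qed

lemma q_sphere_norm:
  assumes "\<omega> \<in> q_sphere p"
  shows "norm \<omega> = 1" "p_part p \<omega> = 0" "q_part p \<omega> = \<omega>"
proof -
  from assms have q: "\<omega> \<in> q_space p" and "para \<omega> \<odot> para \<omega> = - cl_one"
    by (auto simp: q_sphere_def)
  then have "((norm \<omega>)\<^sup>2 - 1) *\<^sub>R (cl_one :: 'a clifford) = 0"
    using para_square[OF q] by (simp add: scaleR_diff_left)
  moreover have "(cl_one :: 'a clifford) \<noteq> 0"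
    by (simp add: cl_one_def axis_eq_0_iff)
  ultimately have "(norm \<omega>)\<^sup>2 = 1" by simp
  then show "norm \<omega> = 1" by (simp add: power2_eq_1_iff) (smt (verit) norm_ge_zero)
  show "p_part p \<omega> = 0" using q by (simp add: q_space_def)
  then show "q_part p \<omega> = \<omega>" using p_part_plus_q_part[of p \<omega>] by simp
qed

lemma slice_coordinates:
  assumes "x \<in> p_space p" "\<omega> \<in> q_sphere p" "0 < r"
  shows "p_part p (x + r *\<^sub>R \<omega>) = x" "norm (q_part p (x + r *\<^sub>R \<omega>)) = r" "q_dir p (x + r *\<^sub>R \<omega>) = \<omega>"
proof -
  have x: "q_part p x = 0" using assms by (simp add: p_space_def)
  then have "p_part p x = x" using p_part_plus_q_part[of p x] by simp
  with x assms q_sphere_norm[OF assms(2)]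
  show "p_part p (x + r *\<^sub>R \<omega>) = x" "norm (q_part p (x + r *\<^sub>R \<omega>)) = r" "q_dir p (x + r *\<^sub>R \<omega>) = \<omega>"
    by (simp_all add: q_dir_def)
qed

text \<open>
  The two components of \<open>\<E>\<^sub>y\<close>, viewed as a stem function of \<open>(x\<^sub>p, r)\<close>.
\<close>

definition slice_even :: "nat \<Rightarrow> 'n::{finite,linorder} paravector \<Rightarrow> 'n paravector \<Rightarrow> real \<Rightarrow> 'n clifford" where
  "slice_even p y x r = (1 / 2) *\<^sub>R (cauchy_kernel p (y - (x + r *\<^sub>R q_dir p y)) + cauchy_kernel p (y - (x - r *\<^sub>R q_dir p y)))"

definition slice_odd :: "nat \<Rightarrow> 'n::{finite,linorder} paravector \<Rightarrow> 'n paravector \<Rightarrow> real \<Rightarrow> 'n clifford" where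
  "slice_odd p y x r = (1 / 2) *\<^sub>R (para (q_dir p y) \<odot>
     (cauchy_kernel p (y - (x - r *\<^sub>R q_dir p y)) - cauchy_kernel p (y - (x + r *\<^sub>R q_dir p y))))"

lemma slice_even_minus: "slice_even p y x (- r) = slice_even p y x r"
  by (simp add: slice_even_def add.commute)

lemma slice_odd_minus: "slice_odd p y x (- r) = - slice_odd p y x r"
proof -
  show ?thesis by (simp add: slice_odd_def cl_mult.diff_right scaleR_diff_right)
qed

lemma slice_kernel_eq:
  "slice_kernel p y x = slice_even p y (p_part p x) (norm (q_part p x))
     + para (q_dir p x) \<odot> slice_odd p y (p_part p x) (norm (q_part p x))"
  unfolding slice_kernel_def slice_even_def slice_odd_def Let_def
  by (simp add: cl_mult.diff_left cl_mult.add_left cl_mult.diff_right cl_mult.scaleR_right cl_one_mult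
      cl_mult_assoc algebra_simps)

text \<open>
  The vectors \<open>y\<^sub>q\<close> and \<open>\<eta>\<close> are collinear, so the \<open>q\<close>-part of the difference has norm \<open>||y\<^sub>q| - r|\<close>, while
  the \<open>p\<close>-part is that of \<open>y - x\<close>.
\<close>

lemma norm_slice_diff:
  assumes "q_part p y \<noteq> 0" "q_part p x = 0"
  shows "norm (y - (x + r *\<^sub>R q_dir p y)) = slice_dist p x r y"
proof -
  let ?\<rho> = "norm (q_part p y)"
  have "q_part p y - r *\<^sub>R q_dir p y = (?\<rho> - r) *\<^sub>R q_dir p y"
    using assms by (simp add: q_dir_def left_diff_distrib scaleR_diff_left)
  moreover have "norm (q_dir p y) = 1" using assms by (simp add: q_dir_def)
  ultimately have q: "norm (q_part p y - r *\<^sub>R q_dir p y) = \<bar>?\<rho> - r\<bar>" by simp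
  have parts: "p_part p (y - (x + r *\<^sub>R q_dir p y)) = p_part p (y - x)"
    "q_part p (y - (x + r *\<^sub>R q_dir p y)) = q_part p y - r *\<^sub>R q_dir p y"
    using assms(2) by (simp_all add: q_dir_def)
  show ?thesis
    unfolding slice_dist_def
    by (rule real_sqrt_unique[symmetric]) (simp_all add: norm_p_part_q_part[of "y - (x + r *\<^sub>R q_dir p y)" p] parts q
        del: linear_part_simps)
qed

text \<open>
  The numerator of \<open>E\<close> is linear in \<open>z\<close>, hence \<open>O(|z|)\<close>.  At \<open>z = 0\<close> both sides are \<open>0\<close>.
\<close>

lemma cauchy_kernel_bound:
  obtains C where "0 \<le> C" "\<And>z::'n::{finite,linorder} paravector. norm (cauchy_kernel p z) \<le> C * norm z powr - (real p + 1)"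
proof -
  have bl: "bounded_linear (\<lambda>z::'n paravector. cl_conj (para z))"
    by (rule bounded_linear_compose[OF bounded_linear_cl_conj bounded_linear_para])
  then obtain K where K: "0 \<le> K" "\<And>z::'n paravector. norm (cl_conj (para z)) \<le> norm z * K"
    using bounded_linear.nonneg_bounded[OF bl] by blast
  define C where "C = \<bar>1 / sphere_area (p + 2)\<bar> * K"
  show thesis
  proof (rule that)
    show "0 \<le> C" using K by (simp add: C_def)
    fix z :: "'n paravector"
    show "norm (cauchy_kernel p z) \<le> C * norm z powr - (real p + 1)"
    proof (cases "z = 0")
      case True
      then have "cl_conj (para z) = 0" using linear_0[OF bounded_linear.linear[OF bl]] True by simp
      then show ?thesis using True by (simp add: cauchy_kernel_def)
    next
      case False
      have "norm (cauchy_kernel p z) = \<bar>1 / sphere_area (p + 2)\<bar> * (norm (cl_conj (para z)) / norm z ^ (p + 2))"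
        by (simp add: cauchy_kernel_def divide_inverse abs_mult abs_inverse mult_ac del: power_Suc)
      also have "\<dots> \<le> \<bar>1 / sphere_area (p + 2)\<bar> * (norm z * K / norm z ^ (p + 2))"
        by (intro mult_left_mono divide_right_mono K) auto
      also have "norm z * K / norm z ^ (p + 2) = K * norm z powr - (real p + 1)"
      proof -
        have "norm z powr (real p + 1) = norm z ^ (p + 1)"
          using False powr_realpow[of "norm z" "p + 1"] by (simp add: add.commute)
        then have "norm z powr - (real p + 1) = inverse (norm z ^ (p + 1))"
          by (simp only: powr_minus)
        moreover have "norm z * K / norm z ^ (p + 2) = K * inverse (norm z ^ (p + 1))"
          using False by (simp add: field_simps)
        ultimately show ?thesis by (simp only:)
      qed
      finally show ?thesis by (simp add: C_def mult_ac)
    qed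
  qed
qed

text \<open>
  The kernel \<open>N\<close> for \<open>r = |x\<^sub>q|\<close>.
\<close>

definition slice_majorant :: "nat \<Rightarrow> 'n::{finite,linorder} paravector \<Rightarrow> real \<Rightarrow> 'n paravector \<Rightarrow> real" where
  "slice_majorant p x r y = slice_dist p x r y powr - (real p + 1) + slice_dist p x (- r) y powr - (real p + 1)"

lemma slice_majorant_nonneg [simp]: "0 \<le> slice_majorant p x r y"
  by (simp add: slice_majorant_def)

lemma slice_majorant_p_part: "slice_majorant p (p_part p x) r y = slice_majorant p x r y"
  by (simp add: slice_majorant_def slice_dist_def)

lemma slice_majorant_sym:
  "slice_majorant p x (norm (q_part p x)) y = slice_majorant p y (norm (q_part p y)) x"
proof -
  have "norm (p_part p y - p_part p x) = norm (p_part p x - p_part p y)" by (rule norm_minus_commute)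
  then show ?thesis
    by (simp add: slice_majorant_def slice_dist_def power2_commute add.commute)
qed

text \<open>
  The Clifford norm is submultiplicative only up to a constant, and \<open>\<omega>\<close>, \<open>\<eta>\<close> are unit vectors or \<open>0\<close>; so all
  three functions are bounded by the two values of the Cauchy kernel that occur in them.
\<close>

lemma slice_kernel_bounds:
  obtains C where "0 \<le> C"
    "\<And>x y :: 'n::{finite,linorder} paravector. \<And>r. q_part p y \<noteq> 0 \<Longrightarrow> q_part p x = 0 \<Longrightarrow> norm (slice_even p y x r) \<le> C * slice_majorant p x r y"
    "\<And>x y :: 'n::{finite,linorder} paravector. \<And>r. q_part p y \<noteq> 0 \<Longrightarrow> q_part p x = 0 \<Longrightarrow> norm (slice_odd p y x r) \<le> C * slice_majorant p x r y"
    "\<And>x y :: 'n::{finite,linorder} paravector. q_part p y \<noteq> 0 \<Longrightarrow> norm (slice_kernel p y x) \<le> C * slice_majorant p x (norm (q_part p x)) y"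
proof -
  obtain E where E: "0 \<le> E" "\<And>z::'n paravector. norm (cauchy_kernel p z) \<le> E * norm z powr - (real p + 1)"
    using cauchy_kernel_bound by blast
  obtain K where K: "0 \<le> K" "\<And>a b::'n clifford. norm (a \<odot> b) \<le> norm a * norm b * K"
    using cl_mult.nonneg_bounded by blast
  obtain P where P: "0 \<le> P" "\<And>x::'n paravector. norm (para x) \<le> norm x * P"
    using bounded_linear.nonneg_bounded[OF bounded_linear_para] by blast
  have dir: "norm (para (q_dir p x)) \<le> P" for x :: "'n paravector"
  proof -
    have "norm (q_dir p x) \<le> 1" by (cases "q_part p x = 0") (simp_all add: q_dir_def)
    then have "norm (q_dir p x) * P \<le> 1 * P" using P by (intro mult_right_mono)
    with P(2)[of "q_dir p x"] show ?thesis by simp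
  qed
  have dir_mult: "norm (para (q_dir p x) \<odot> a) \<le> P * K * norm a" for x :: "'n paravector" and a :: "'n clifford"
  proof -
    have "norm (para (q_dir p x) \<odot> a) \<le> norm (para (q_dir p x)) * norm a * K" by (rule K)
    also have "\<dots> \<le> P * norm a * K" using dir K by (intro mult_right_mono) auto
    finally show ?thesis by (simp add: mult_ac)
  qed
  have EE: "norm (cauchy_kernel p (y - (x + r *\<^sub>R q_dir p y))) + norm (cauchy_kernel p (y - (x - r *\<^sub>R q_dir p y)))
      \<le> E * slice_majorant p x r y" if "q_part p y \<noteq> 0" "q_part p x = 0" for x y :: "'n paravector" and r
    using E(2)[of "y - (x + r *\<^sub>R q_dir p y)"] E(2)[of "y - (x - r *\<^sub>R q_dir p y)"]
      norm_slice_diff[OF that, of r] norm_slice_diff[OF that, of "- r"]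
    by (simp add: slice_majorant_def distrib_left)
  have even: "norm (slice_even p y x r) \<le> E * slice_majorant p x r y"
    if "q_part p y \<noteq> 0" "q_part p x = 0" for x y :: "'n paravector" and r
  proof -
    let ?a = "cauchy_kernel p (y - (x + r *\<^sub>R q_dir p y))" and ?b = "cauchy_kernel p (y - (x - r *\<^sub>R q_dir p y))"
    have "norm (slice_even p y x r) \<le> norm (?a + ?b)" by (simp add: slice_even_def)
    also have "\<dots> \<le> norm ?a + norm ?b" by (rule norm_triangle_ineq)
    also note EE[OF that]
    finally show ?thesis .
  qed
  have odd: "norm (slice_odd p y x r) \<le> P * K * E * slice_majorant p x r y"
    if "q_part p y \<noteq> 0" "q_part p x = 0" for x y :: "'n paravector" and r
  proof -
    let ?a = "cauchy_kernel p (y - (x + r *\<^sub>R q_dir p y))" and ?b = "cauchy_kernel p (y - (x - r *\<^sub>R q_dir p y))"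
    have "norm (slice_odd p y x r) \<le> norm (para (q_dir p y) \<odot> (?b - ?a))" by (simp add: slice_odd_def)
    also have "\<dots> \<le> P * K * norm (?b - ?a)" by (rule dir_mult)
    also have "\<dots> \<le> P * K * (norm ?a + norm ?b)"
      using P K norm_triangle_ineq4[of ?b ?a] by (intro mult_left_mono) auto
    also have "\<dots> \<le> P * K * (E * slice_majorant p x r y)"
      using P K EE[OF that] by (intro mult_left_mono) auto
    finally show ?thesis by (simp add: mult_ac)
  qed
  define C where "C = E + P * K * E + P * K * (P * K * E)"
  have PKE: "0 \<le> P * K * E" "0 \<le> P * K * (P * K * E)" using P K E by auto
  show thesis
  proof (rule that)
    show "0 \<le> C" using E PKE by (simp add: C_def)
    fix x y :: "'n paravector" assume y: "q_part p y \<noteq> 0"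
    have le: "E * slice_majorant p x r y \<le> C * slice_majorant p x r y"
        "P * K * E * slice_majorant p x r y \<le> C * slice_majorant p x r y" for x :: "'n paravector" and r
      using E PKE by (auto intro!: mult_right_mono simp: C_def)
    show "norm (slice_even p y x r) \<le> C * slice_majorant p x r y" if "q_part p x = 0" for r
      using even[OF y that] le(1) by (rule order.trans)
    show "norm (slice_odd p y x r) \<le> C * slice_majorant p x r y" if "q_part p x = 0" for r
      using odd[OF y that] le(2) by (rule order.trans)
    let ?r = "norm (q_part p x)"
    have "norm (slice_kernel p y x) \<le> norm (slice_even p y (p_part p x) ?r) + norm (para (q_dir p x) \<odot> slice_odd p y (p_part p x) ?r)"
      unfolding slice_kernel_eq by (rule norm_triangle_ineq)
    also have "\<dots> \<le> E * slice_majorant p x ?r y + P * K * (P * K * E * slice_majorant p x ?r y)"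
    proof (intro add_mono)
      show "norm (slice_even p y (p_part p x) ?r) \<le> E * slice_majorant p x ?r y"
        using even[OF y, of "p_part p x" ?r] by (simp add: slice_majorant_p_part)
      have "P * K * norm (slice_odd p y (p_part p x) ?r) \<le> P * K * (P * K * E * slice_majorant p x ?r y)"
        using odd[OF y, of "p_part p x" ?r] P K by (intro mult_left_mono) (simp_all add: slice_majorant_p_part)
      with dir_mult[of x "slice_odd p y (p_part p x) ?r"]
      show "norm (para (q_dir p x) \<odot> slice_odd p y (p_part p x) ?r) \<le> P * K * (P * K * E * slice_majorant p x ?r y)"
        by (rule order.trans)
    qed
    also have "\<dots> = (E + P * K * (P * K * E)) * slice_majorant p x ?r y"
      by (simp add: algebra_simps)
    also have "\<dots> \<le> C * slice_majorant p x ?r y"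
      using PKE by (intro mult_right_mono) (simp_all add: C_def)
    finally show "norm (slice_kernel p y x) \<le> C * slice_majorant p x ?r y" .
  qed
qed

section \<open>Measurability\<close>

lemma measurable_lebesgue_on_borel: "(\<lambda>x. x) \<in> lebesgue_on \<Omega> \<rightarrow>\<^sub>M borel"
  by (intro measurable_restrict_space1 measurable_completion) simp

lemma borel_measurable_lebesgue_onI: "g \<in> borel_measurable borel \<Longrightarrow> g \<in> borel_measurable (lebesgue_on \<Omega>)"
  by (rule measurable_compose[OF measurable_lebesgue_on_borel])

text \<open>
  The product of the Lebesgue measure spaces is not complete, so joint measurability is always
  obtained from joint Borel measurability.
\<close>

lemma borel_measurable_lebesgue_on_pairI:
  assumes "g \<in> borel_measurable (borel \<Otimes>\<^sub>M borel)"
  shows "g \<in> borel_measurable (lebesgue_on \<Omega> \<Otimes>\<^sub>M lebesgue_on \<Omega>)"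
proof -
  have "(\<lambda>z. (fst z, snd z)) \<in> (lebesgue_on \<Omega> \<Otimes>\<^sub>M lebesgue_on \<Omega>) \<rightarrow>\<^sub>M (borel \<Otimes>\<^sub>M borel)"
    by (intro measurable_Pair measurable_compose[OF measurable_fst measurable_lebesgue_on_borel]
        measurable_compose[OF measurable_snd measurable_lebesgue_on_borel])
  from measurable_compose[OF this assms] show ?thesis by simp
qed

lemma borel_measurable_cl_mult [measurable]:
  fixes f g :: "'a \<Rightarrow> 'n::{finite,linorder} clifford"
  assumes "f \<in> borel_measurable M" "g \<in> borel_measurable M"
  shows "(\<lambda>x. f x \<odot> g x) \<in> borel_measurable M"
proof (rule borel_measurable_continuous_Pair[OF assms])
  show "continuous_on UNIV (\<lambda>x::'n clifford \<times> 'n clifford. fst x \<odot> snd x)"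
    by (intro cl_mult.continuous_on continuous_intros)
qed

lemma borel_measurable_para [measurable]: "para \<in> borel_measurable borel"
  by (intro borel_measurable_continuous_onI linear_continuous_on bounded_linear_para)

lemma borel_measurable_cl_conj [measurable]: "cl_conj \<in> borel_measurable borel"
  by (intro borel_measurable_continuous_onI linear_continuous_on bounded_linear_cl_conj)

lemma borel_measurable_q_dir [measurable]: "q_dir p \<in> borel_measurable borel"
  unfolding q_dir_def[abs_def] by measurable

lemma borel_measurable_cauchy_kernel [measurable]: "cauchy_kernel p \<in> borel_measurable borel"
  unfolding cauchy_kernel_def[abs_def] by measurable

lemma borel_measurable_slice_even [measurable]: "(\<lambda>y. slice_even p y x r) \<in> borel_measurable borel"
  unfolding slice_even_def by measurable

lemma borel_measurable_slice_odd [measurable]: "(\<lambda>y. slice_odd p y x r) \<in> borel_measurable borel"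
  unfolding slice_odd_def by measurable

lemma borel_measurable_teodorescu_kernel:
  "(\<lambda>(x, y). teodorescu_kernel p q y x) \<in> borel_measurable (borel \<Otimes>\<^sub>M borel)"
  unfolding teodorescu_kernel_def slice_kernel_def Let_def by measurable

lemma borel_measurable_slice_majorant:
  "(\<lambda>(x, y). slice_majorant p x (norm (q_part p x)) y) \<in> borel_measurable (borel \<Otimes>\<^sub>M borel)"
  unfolding slice_majorant_def slice_dist_def by measurable

section \<open>The weighted Schur test\<close>

lemma slice_majorant_bound:
  fixes \<Omega> :: "'n::{finite,linorder} paravector set"
  assumes n: "CARD('n) = p + q" "1 \<le> q" and c: "0 \<le> c" "c < real q"
    and \<Omega>: "\<Omega> \<in> sets lebesgue" "bounded \<Omega>"
  obtains A where "0 \<le> A" "\<And>x. x \<in> \<Omega> \<Longrightarrow>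
    (\<integral>\<^sup>+y. ennreal (norm (q_part p y) powr - c * slice_majorant p x (norm (q_part p x)) y) \<partial>lebesgue_on \<Omega>) \<le> ennreal A"
proof -
  obtain L where L: "0 < L" "\<And>y. y \<in> \<Omega> \<Longrightarrow> norm y \<le> L"
    using \<Omega>(2) bounded_pos by blast
  obtain A where A: "0 \<le> A" "\<And>x r. x \<in> \<Omega> \<Longrightarrow> \<bar>r\<bar> \<le> L \<Longrightarrow>
    (\<integral>\<^sup>+y. ennreal (norm (q_part p y) powr - c * slice_dist p x r y powr - (real p + 1)) \<partial>lebesgue_on \<Omega>) \<le> ennreal A"
    using weighted_slice_kernel_bound[OF n c \<Omega>(1) L(2) L(1)] by blast
  show thesis
  proof (rule that)
    show "0 \<le> 2 * A" using A by simp
    fix x assume x: "x \<in> \<Omega>"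
    have "norm (q_part p x) \<le> norm x"
      by (rule power2_le_imp_le) (simp_all add: norm_p_part_q_part[of x p])
    then have r: "\<bar>norm (q_part p x)\<bar> \<le> L" "\<bar>- norm (q_part p x)\<bar> \<le> L" using L(2)[OF x] by auto
    let ?f = "\<lambda>r y. norm (q_part p y) powr - c * slice_dist p x r y powr - (real p + 1)"
    have [measurable]: "(\<lambda>y. ennreal (?f r y)) \<in> borel_measurable (lebesgue_on \<Omega>)" for r
      by (rule borel_measurable_lebesgue_onI) measurable
    have "(\<integral>\<^sup>+y. ennreal (norm (q_part p y) powr - c * slice_majorant p x (norm (q_part p x)) y) \<partial>lebesgue_on \<Omega>)
        = (\<integral>\<^sup>+y. ennreal (?f (norm (q_part p x)) y) + ennreal (?f (- norm (q_part p x)) y) \<partial>lebesgue_on \<Omega>)"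
      by (simp add: slice_majorant_def distrib_left)
    also have "\<dots> = (\<integral>\<^sup>+y. ennreal (?f (norm (q_part p x)) y) \<partial>lebesgue_on \<Omega>) + (\<integral>\<^sup>+y. ennreal (?f (- norm (q_part p x)) y) \<partial>lebesgue_on \<Omega>)"
      by (rule nn_integral_add) measurable
    also have "\<dots> \<le> ennreal A + ennreal A"
      using r by (intro add_mono A(2)[OF x])
    also have "\<dots> = ennreal (A + A)"
      by (rule ennreal_plus[symmetric]) (rule A(1))+
    also have "A + A = 2 * A" by simp
    finally show "(\<integral>\<^sup>+y. ennreal (norm (q_part p y) powr - c * slice_majorant p x (norm (q_part p x)) y) \<partial>lebesgue_on \<Omega>) \<le> ennreal (2 * A)" .
  qed
qed

text \<open>
  The scalar integral that dominates the Teodorescu transform.  It depends on \<open>x\<close> only through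
  \<open>(x\<^sub>p, |x\<^sub>q|)\<close>, and its value is \<open>\<infinity>\<close> where the integral diverges.
\<close>

definition slice_potential :: "nat \<Rightarrow> nat \<Rightarrow> 'n::{finite,linorder} paravector set \<Rightarrow> ('n paravector \<Rightarrow> 'n clifford) \<Rightarrow> 'n paravector \<Rightarrow> ennreal" where
  "slice_potential p q \<Omega> f x = (\<integral>\<^sup>+y. ennreal (norm (q_part p y) powr - (real q - 1) *
      slice_majorant p x (norm (q_part p x)) y * norm (f y)) \<partial>lebesgue_on \<Omega>)"

lemma borel_measurable_slice_potential:
  assumes "\<Omega> \<in> sets lebesgue" "bounded \<Omega>" and [measurable]: "f \<in> borel_measurable (lebesgue_on \<Omega>)"
  shows "slice_potential p q \<Omega> f \<in> borel_measurable (lebesgue_on \<Omega>)"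
proof -
  interpret finite_measure "lebesgue_on \<Omega>"
    using assms by (intro finite_measure_lebesgue_on bounded_set_imp_lmeasurable)
  have [measurable]: "(\<lambda>(x, y). slice_majorant p x (norm (q_part p x)) y) \<in> borel_measurable (lebesgue_on \<Omega> \<Otimes>\<^sub>M lebesgue_on \<Omega>)"
    by (rule borel_measurable_lebesgue_on_pairI[OF borel_measurable_slice_majorant])
  have [measurable]: "(\<lambda>y. norm (q_part p y)) \<in> borel_measurable (lebesgue_on \<Omega>)"
    by (rule borel_measurable_lebesgue_onI) measurable
  show ?thesis
    unfolding slice_potential_def[abs_def] by measurable
qed

text \<open>
  The Schur test.  Where \<open>\<Psi>(x) = \<integral> N(x, y) |f(y)|\<^sup>t dy\<close> is finite, which is almost everywhere, Hoelder's
  inequality bounds the \<open>t\<close>-th power of the potential by \<open>A\<^bsup>t/s\<^esup> \<Psi>(x)\<close>; the integral of \<open>\<Psi>\<close> is at most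
  \<open>B \<parallel>f\<parallel>\<^sub>t\<^sup>t\<close> by Tonelli's theorem and the symmetry of \<open>N\<close>.
\<close>

lemma slice_potential_Lt_bound:
  fixes \<Omega> :: "'n::{finite,linorder} paravector set"
  assumes n: "CARD('n) = p + q" "1 \<le> q"
    and \<Omega>: "\<Omega> \<in> sets lebesgue" "bounded \<Omega>" "\<Omega> \<subseteq> - p_space p" and t: "real q < t"
  obtains M where "0 \<le> M" "\<And>f. f \<in> Lt_space t \<Omega> \<Longrightarrow> AE x in lebesgue_on \<Omega>. slice_potential p q \<Omega> f x < \<infinity>"
    "\<And>f. f \<in> Lt_space t \<Omega> \<Longrightarrow> (\<integral>\<^sup>+x. ennreal (enn2real (slice_potential p q \<Omega> f x) powr t) \<partial>lebesgue_on \<Omega>)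
       \<le> ennreal (M * (\<integral>x. norm (f x) powr t \<partial>lebesgue_on \<Omega>))"
proof -
  define N where "N x y = slice_majorant p x (norm (q_part p x)) y" for x y :: "'n paravector"
  let ?\<mu> = "lebesgue_on \<Omega>"
  define s where "s = t / (t - 1)"
  have "1 < t" using n t by auto
  then have s: "1 < s" "1 / s + 1 / t = 1" by (simp_all add: s_def field_simps)
  \<comment> \<open>The upper bound is \<open>(q - 1) t < q (t - 1)\<close>, which is the hypothesis \<open>q < t\<close>.\<close>
  have c: "0 \<le> (real q - 1) * s" "(real q - 1) * s < real q"
    using n t \<open>1 < t\<close> s by (simp_all add: s_def field_simps)
  obtain A where A: "0 \<le> A" "\<And>x. x \<in> \<Omega> \<Longrightarrow>
      (\<integral>\<^sup>+y. ennreal (norm (q_part p y) powr - ((real q - 1) * s) * N x y) \<partial>?\<mu>) \<le> ennreal A"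
    using slice_majorant_bound[OF n c \<Omega>(1,2)] unfolding N_def by blast
  obtain B where B: "0 \<le> B" "\<And>x. x \<in> \<Omega> \<Longrightarrow>
      (\<integral>\<^sup>+y. ennreal (norm (q_part p y) powr - 0 * N x y) \<partial>?\<mu>) \<le> ennreal B"
    using slice_majorant_bound[OF n _ _ \<Omega>(1,2), of 0] n unfolding N_def by auto
  have q0: "q_part p y \<noteq> 0" if "y \<in> \<Omega>" for y
    using \<Omega>(3) that by (auto simp: p_space_def)
  have B': "(\<integral>\<^sup>+y. ennreal (N x y) \<partial>?\<mu>) \<le> ennreal B" if "x \<in> \<Omega>" for x
  proof -
    have "(\<integral>\<^sup>+y. ennreal (N x y) \<partial>?\<mu>) = (\<integral>\<^sup>+y. ennreal (norm (q_part p y) powr - 0 * N x y) \<partial>?\<mu>)"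
      by (rule nn_integral_cong) (auto dest: q0)
    with B(2)[OF that] show ?thesis by simp
  qed
  have N0: "0 \<le> N x y" for x y by (simp add: N_def)
  have Nsym: "N x y = N y x" for x y unfolding N_def by (rule slice_majorant_sym)
  have [measurable]: "(\<lambda>(x, y). N x y) \<in> borel_measurable (?\<mu> \<Otimes>\<^sub>M ?\<mu>)"
    unfolding N_def by (rule borel_measurable_lebesgue_on_pairI[OF borel_measurable_slice_majorant])
  have [measurable]: "(\<lambda>y. norm (q_part p y)) \<in> borel_measurable ?\<mu>"
    by (rule borel_measurable_lebesgue_onI) measurable
  have [measurable]: "(\<lambda>y. N x y) \<in> borel_measurable ?\<mu>" for x
    unfolding N_def slice_majorant_def by (rule borel_measurable_lebesgue_onI) measurable
  interpret \<mu>: finite_measure ?\<mu>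
    using \<Omega> by (intro finite_measure_lebesgue_on bounded_set_imp_lmeasurable)
  interpret \<mu>\<mu>: pair_sigma_finite ?\<mu> ?\<mu> ..
  define M where "M = A powr (t / s) * B"
  have "0 \<le> M" using B by (simp add: M_def)
  have "(AE x in ?\<mu>. slice_potential p q \<Omega> f x < \<infinity>) \<and>
      (\<integral>\<^sup>+x. ennreal (enn2real (slice_potential p q \<Omega> f x) powr t) \<partial>?\<mu>)
       \<le> ennreal (M * (\<integral>x. norm (f x) powr t \<partial>?\<mu>))" if f: "f \<in> Lt_space t \<Omega>" for f
  proof -
    from f have [measurable]: "f \<in> borel_measurable ?\<mu>" and int: "integrable ?\<mu> (\<lambda>x. norm (f x) powr t)"
      by (auto simp: Lt_space_def)
    define J where "J = (\<integral>x. norm (f x) powr t \<partial>?\<mu>)"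
    have J: "0 \<le> J" by (simp add: J_def)
    have J_eq: "(\<integral>\<^sup>+x. ennreal (norm (f x) powr t) \<partial>?\<mu>) = ennreal J"
      unfolding J_def by (rule nn_integral_eq_integral[OF int]) simp
    define \<Psi> where "\<Psi> x = (\<integral>\<^sup>+y. ennreal (N x y * norm (f y) powr t) \<partial>?\<mu>)" for x
    have [measurable]: "\<Psi> \<in> borel_measurable ?\<mu>"
      unfolding \<Psi>_def[abs_def] by measurable
    have "(\<integral>\<^sup>+x. \<Psi> x \<partial>?\<mu>) = (\<integral>\<^sup>+y. (\<integral>\<^sup>+x. ennreal (N x y * norm (f y) powr t) \<partial>?\<mu>) \<partial>?\<mu>)"
      unfolding \<Psi>_def by (rule \<mu>\<mu>.Fubini'[symmetric]) measurable
    also have "\<dots> \<le> (\<integral>\<^sup>+y. ennreal B * ennreal (norm (f y) powr t) \<partial>?\<mu>)"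
    proof (rule nn_integral_mono)
      fix y assume "y \<in> space ?\<mu>"
      then have y: "y \<in> \<Omega>" by simp
      have "(\<integral>\<^sup>+x. ennreal (N x y * norm (f y) powr t) \<partial>?\<mu>)
          = (\<integral>\<^sup>+x. ennreal (N y x) \<partial>?\<mu>) * ennreal (norm (f y) powr t)"
        by (subst nn_integral_multc[symmetric]) (auto simp: ennreal_mult N0 Nsym[of _ y])
      also have "\<dots> \<le> ennreal B * ennreal (norm (f y) powr t)"
        by (intro mult_right_mono B'[OF y]) simp
      finally show "(\<integral>\<^sup>+x. ennreal (N x y * norm (f y) powr t) \<partial>?\<mu>) \<le> ennreal B * ennreal (norm (f y) powr t)" .
    qed
    also have "\<dots> = ennreal (B * J)"
      using B(1) J by (simp add: nn_integral_cmult J_eq ennreal_mult)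
    finally have \<Psi>_int: "(\<integral>\<^sup>+x. \<Psi> x \<partial>?\<mu>) \<le> ennreal (B * J)" .
    then have "(\<integral>\<^sup>+x. \<Psi> x \<partial>?\<mu>) \<noteq> \<infinity>"
      by (metis ennreal_less_top infinity_ennreal_def not_le)
    then have fin: "AE x in ?\<mu>. \<Psi> x \<noteq> \<infinity>"
      by (rule nn_integral_PInf_AE[rotated]) measurable
    have pw: "slice_potential p q \<Omega> f x < \<infinity> \<and>
        ennreal (enn2real (slice_potential p q \<Omega> f x) powr t) \<le> ennreal (A powr (t / s)) * \<Psi> x"
      if x: "x \<in> \<Omega>" and "\<Psi> x \<noteq> \<infinity>" for x
    proof -
      obtain b where b: "0 \<le> b" "\<Psi> x = ennreal b"
        using \<open>\<Psi> x \<noteq> \<infinity>\<close> by (cases "\<Psi> x") auto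
      let ?a = "\<lambda>y. norm (q_part p y) powr - (real q - 1) * N x y powr (1 / s)"
      let ?b = "\<lambda>y. N x y powr (1 / t) * norm (f y)"
      have "slice_potential p q \<Omega> f x = (\<integral>\<^sup>+y. ennreal (?a y * ?b y) \<partial>?\<mu>)"
        unfolding slice_potential_def N_def[symmetric]
      proof (rule nn_integral_cong, rule arg_cong[where f = ennreal])
        fix y
        have "N x y = N x y powr (1 / s) * N x y powr (1 / t)"
          using s N0 by (simp add: powr_add[symmetric])
        then show "norm (q_part p y) powr - (real q - 1) * N x y * norm (f y) = ?a y * ?b y"
          by (metis mult.assoc)
      qed
      also have "\<dots> \<le> ennreal (A powr (1 / s) * b powr (1 / t))"
      proof (rule nn_integral_Holder)
        have "?a y powr s = norm (q_part p y) powr - ((real q - 1) * s) * N x y" for y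
        proof -
          have "(norm (q_part p y) powr - (real q - 1)) powr s = norm (q_part p y) powr - ((real q - 1) * s)"
            by (simp only: powr_powr minus_mult_left)
          moreover have "(N x y powr (1 / s)) powr s = N x y"
            using s N0 by (simp add: powr_powr)
          ultimately show ?thesis
            by (simp only: powr_mult)
        qed
        then show "(\<integral>\<^sup>+y. ennreal (?a y powr s) \<partial>?\<mu>) \<le> ennreal A" using A(2)[OF x] by simp
        have "?b y powr t = N x y * norm (f y) powr t" for y
          using \<open>1 < t\<close> N0 by (simp add: powr_mult powr_powr)
        then show "(\<integral>\<^sup>+y. ennreal (?b y powr t) \<partial>?\<mu>) \<le> ennreal b" using b by (simp add: \<Psi>_def)
      qed (use s A(1) b(1) \<open>1 < t\<close> in auto)
      finally have le: "slice_potential p q \<Omega> f x \<le> ennreal (A powr (1 / s) * b powr (1 / t))" .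
      then have lt: "slice_potential p q \<Omega> f x < \<infinity>"
        by (metis ennreal_less_top infinity_ennreal_def le_less_trans)
      have "enn2real (slice_potential p q \<Omega> f x) \<le> A powr (1 / s) * b powr (1 / t)"
        using enn2real_mono[OF le] by (simp add: enn2real_ennreal)
      then have "enn2real (slice_potential p q \<Omega> f x) powr t \<le> (A powr (1 / s) * b powr (1 / t)) powr t"
        using \<open>1 < t\<close> by (intro powr_mono2) auto
      also have "\<dots> = A powr (t / s) * b"
        using b(1) \<open>1 < t\<close> by (simp add: powr_mult powr_powr)
      finally show ?thesis
        using lt b by (simp add: ennreal_mult[symmetric] ennreal_leI)
    qed
    have pw': "AE x in ?\<mu>. slice_potential p q \<Omega> f x < \<infinity> \<and>
        ennreal (enn2real (slice_potential p q \<Omega> f x) powr t) \<le> ennreal (A powr (t / s)) * \<Psi> x"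
      using fin AE_space by eventually_elim (use pw in auto)
    have "(\<integral>\<^sup>+x. ennreal (enn2real (slice_potential p q \<Omega> f x) powr t) \<partial>?\<mu>)
        \<le> (\<integral>\<^sup>+x. ennreal (A powr (t / s)) * \<Psi> x \<partial>?\<mu>)"
      using pw' by (intro nn_integral_mono_AE) (auto elim: eventually_mono)
    also have "\<dots> = ennreal (A powr (t / s)) * (\<integral>\<^sup>+x. \<Psi> x \<partial>?\<mu>)"
      by (rule nn_integral_cmult) measurable
    also have "\<dots> \<le> ennreal (A powr (t / s)) * ennreal (B * J)"
      by (intro mult_left_mono \<Psi>_int) simp
    also have "\<dots> = ennreal (M * J)"
      using B J by (simp add: M_def ennreal_mult[symmetric] mult.assoc)
    finally show ?thesis
      using pw' by (auto simp: J_def elim: eventually_mono)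
  qed
  with \<open>0 \<le> M\<close> show thesis using that by blast
qed

section \<open>The Teodorescu transform\<close>

lemma teodorescu_kernel_eq:
  "teodorescu_kernel p q y x \<odot> a
    = (1 / (sphere_area q * norm (q_part p y) ^ (q - 1))) *\<^sub>R (slice_even p y (p_part p x) (norm (q_part p x)) \<odot> a)
    + para (q_dir p x) \<odot> ((1 / (sphere_area q * norm (q_part p y) ^ (q - 1))) *\<^sub>R (slice_odd p y (p_part p x) (norm (q_part p x)) \<odot> a))"
  by (simp add: teodorescu_kernel_def slice_kernel_eq cl_mult.scaleR_left cl_mult.scaleR_right cl_mult.add_left
      cl_mult_assoc scaleR_add_right)

lemma weighted_kernel_norm_le:
  fixes k a :: "'n::{finite,linorder} clifford"
  assumes "1 \<le> q" "q_part p y \<noteq> 0" "norm k \<le> C * N" "0 \<le> K" "\<And>a b::'n clifford. norm (a \<odot> b) \<le> norm a * norm b * K"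
  shows "norm ((1 / (sphere_area q * norm (q_part p y) ^ (q - 1))) *\<^sub>R (k \<odot> a))
    \<le> \<bar>1 / sphere_area q\<bar> * C * K * (norm (q_part p y) powr - (real q - 1) * N * norm a)"
proof -
  have w: "norm (q_part p y) powr - (real q - 1) = inverse (norm (q_part p y) ^ (q - 1))"
  proof -
    have "norm (q_part p y) powr (real q - 1) = norm (q_part p y) ^ (q - 1)"
      using assms(1,2) powr_realpow[of "norm (q_part p y)" "q - 1"] by (simp add: of_nat_diff)
    then show ?thesis by (simp only: powr_minus)
  qed
  have "norm ((1 / (sphere_area q * norm (q_part p y) ^ (q - 1))) *\<^sub>R (k \<odot> a))
      = \<bar>1 / sphere_area q\<bar> * norm (q_part p y) powr - (real q - 1) * norm (k \<odot> a)"
    unfolding w by (simp add: divide_inverse abs_mult abs_inverse power_abs)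
  also have "\<dots> \<le> \<bar>1 / sphere_area q\<bar> * norm (q_part p y) powr - (real q - 1) * ((C * N) * norm a * K)"
  proof (intro mult_left_mono)
    have "norm (k \<odot> a) \<le> norm k * norm a * K" by (rule assms(5))
    also have "\<dots> \<le> (C * N) * norm a * K" using assms by (intro mult_right_mono) auto
    finally show "norm (k \<odot> a) \<le> (C * N) * norm a * K" .
  qed auto
  finally show ?thesis by (simp add: mult_ac)
qed

text \<open>
  A finite potential dominates the integrand as well as its even and odd parts.  Both parts are therefore
  integrable, and the splitting of the kernel passes to the integral.
\<close>

lemma teodorescu_dominated:
  fixes \<Omega> :: "'n::{finite,linorder} paravector set"
  assumes q: "1 \<le> q" and \<Omega>: "\<Omega> \<subseteq> - p_space p"
  obtains C where "0 \<le> C"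
    "\<And>f x. f \<in> borel_measurable (lebesgue_on \<Omega>) \<Longrightarrow> slice_potential p q \<Omega> f x < \<infinity> \<Longrightarrow>
      integrable (lebesgue_on \<Omega>) (\<lambda>y. teodorescu_kernel p q y x \<odot> f y)
      \<and> norm (teodorescu p q \<Omega> f x) \<le> C * enn2real (slice_potential p q \<Omega> f x)
      \<and> teodorescu p q \<Omega> f x =
          - (\<integral>y. (1 / (sphere_area q * norm (q_part p y) ^ (q - 1))) *\<^sub>R (slice_even p y (p_part p x) (norm (q_part p x)) \<odot> f y) \<partial>lebesgue_on \<Omega>)
          + para (q_dir p x) \<odot>
          - (\<integral>y. (1 / (sphere_area q * norm (q_part p y) ^ (q - 1))) *\<^sub>R (slice_odd p y (p_part p x) (norm (q_part p x)) \<odot> f y) \<partial>lebesgue_on \<Omega>)"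
proof -
  let ?\<mu> = "lebesgue_on \<Omega>"
  obtain C0 where C0: "0 \<le> C0"
    "\<And>x y :: 'n paravector. \<And>r. q_part p y \<noteq> 0 \<Longrightarrow> q_part p x = 0 \<Longrightarrow> norm (slice_even p y x r) \<le> C0 * slice_majorant p x r y"
    "\<And>x y :: 'n paravector. \<And>r. q_part p y \<noteq> 0 \<Longrightarrow> q_part p x = 0 \<Longrightarrow> norm (slice_odd p y x r) \<le> C0 * slice_majorant p x r y"
    "\<And>x y :: 'n paravector. q_part p y \<noteq> 0 \<Longrightarrow> norm (slice_kernel p y x) \<le> C0 * slice_majorant p x (norm (q_part p x)) y"
    using slice_kernel_bounds[where p = p] by blast
  obtain K where K: "0 \<le> K" "\<And>a b::'n clifford. norm (a \<odot> b) \<le> norm a * norm b * K"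
    using cl_mult.nonneg_bounded by blast
  define C where "C = \<bar>1 / sphere_area q\<bar> * C0 * K"
  have "0 \<le> C" using C0 K by (simp add: C_def)
  have q0: "q_part p y \<noteq> 0" if "y \<in> \<Omega>" for y
    using \<Omega> that by (auto simp: p_space_def)
  have [measurable]: "(\<lambda>y. slice_even p y x r) \<in> borel_measurable ?\<mu>" "(\<lambda>y. slice_odd p y x r) \<in> borel_measurable ?\<mu>"
    "(\<lambda>y. 1 / (sphere_area q * norm (q_part p y) ^ (q - 1))) \<in> borel_measurable ?\<mu>"
    for x and r
    by (rule borel_measurable_lebesgue_onI, measurable)+
  \<comment> \<open>Dominated integration, to be used for the full kernel and for each of its two parts.\<close>
  have main: "integrable ?\<mu> k" "norm (\<integral>y. k y \<partial>?\<mu>) \<le> C * enn2real (slice_potential p q \<Omega> f x)"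
    if "k \<in> borel_measurable ?\<mu>" and fin: "slice_potential p q \<Omega> f x < \<infinity>" and f: "f \<in> borel_measurable ?\<mu>"
      and le: "\<And>y. y \<in> \<Omega> \<Longrightarrow> norm (k y) \<le> C * (norm (q_part p y) powr - (real q - 1) * slice_majorant p x (norm (q_part p x)) y * norm (f y))"
    for k f :: "'n paravector \<Rightarrow> 'n clifford" and x
  proof -
    have [measurable]: "f \<in> borel_measurable ?\<mu>" by (rule f)
    have [measurable]: "(\<lambda>y. norm (q_part p y) powr - (real q - 1) * slice_majorant p x (norm (q_part p x)) y) \<in> borel_measurable ?\<mu>"
      unfolding slice_majorant_def by (rule borel_measurable_lebesgue_onI) measurable
    have "(\<integral>\<^sup>+y. ennreal (norm (k y)) \<partial>?\<mu>)
        \<le> (\<integral>\<^sup>+y. ennreal C * ennreal (norm (q_part p y) powr - (real q - 1) * slice_majorant p x (norm (q_part p x)) y * norm (f y)) \<partial>?\<mu>)"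
      using le \<open>0 \<le> C\<close> by (intro nn_integral_mono) (auto simp: ennreal_mult[symmetric] intro!: ennreal_leI)
    also have "\<dots> = ennreal C * slice_potential p q \<Omega> f x"
      unfolding slice_potential_def by (rule nn_integral_cmult) measurable
    finally have 1: "(\<integral>\<^sup>+y. ennreal (norm (k y)) \<partial>?\<mu>) \<le> ennreal C * slice_potential p q \<Omega> f x" .
    also have "\<dots> < \<infinity>" using fin by (simp add: ennreal_mult_less_top)
    finally have 2: "(\<integral>\<^sup>+y. ennreal (norm (k y)) \<partial>?\<mu>) < \<infinity>" .
    show int: "integrable ?\<mu> k"
      using that(1) 2 by (rule integrableI_bounded)
    have "ennreal (norm (\<integral>y. k y \<partial>?\<mu>)) \<le> (\<integral>\<^sup>+y. ennreal (norm (k y)) \<partial>?\<mu>)"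
      using int by (rule integral_norm_bound_ennreal)
    also note 1
    also have "ennreal C * slice_potential p q \<Omega> f x = ennreal (C * enn2real (slice_potential p q \<Omega> f x))"
      using fin \<open>0 \<le> C\<close> by (simp add: ennreal_mult)
    finally show "norm (\<integral>y. k y \<partial>?\<mu>) \<le> C * enn2real (slice_potential p q \<Omega> f x)"
      using \<open>0 \<le> C\<close> by (simp add: ennreal_le_iff)
  qed
  show thesis
  proof (rule that)
    show "0 \<le> C" by fact
    fix f :: "'n paravector \<Rightarrow> 'n clifford" and x
    assume f: "f \<in> borel_measurable ?\<mu>" and fin: "slice_potential p q \<Omega> f x < \<infinity>"
    have [measurable]: "f \<in> borel_measurable ?\<mu>" by (rule f)
    let ?w = "\<lambda>y. 1 / (sphere_area q * norm (q_part p y) ^ (q - 1))"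
    let ?e = "\<lambda>y. ?w y *\<^sub>R (slice_even p y (p_part p x) (norm (q_part p x)) \<odot> f y)"
    let ?o = "\<lambda>y. ?w y *\<^sub>R (slice_odd p y (p_part p x) (norm (q_part p x)) \<odot> f y)"
    let ?k = "\<lambda>y. teodorescu_kernel p q y x \<odot> f y"
    have me: "?e \<in> borel_measurable ?\<mu>" and mo: "?o \<in> borel_measurable ?\<mu>" by measurable
    have mk: "?k \<in> borel_measurable ?\<mu>"
      unfolding teodorescu_kernel_eq using me mo by measurable
    have e: "integrable ?\<mu> ?e"
    proof (rule main(1)[OF me fin f])
      fix y assume "y \<in> \<Omega>"
      then have y: "q_part p y \<noteq> 0" by (rule q0)
      have "norm (slice_even p y (p_part p x) (norm (q_part p x))) \<le> C0 * slice_majorant p x (norm (q_part p x)) y"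
        using C0(2)[OF y, of "p_part p x" "norm (q_part p x)"] by (simp add: slice_majorant_p_part)
      from weighted_kernel_norm_le[OF q y this K]
      show "norm (?e y) \<le> C * (norm (q_part p y) powr - (real q - 1) * slice_majorant p x (norm (q_part p x)) y * norm (f y))"
        unfolding C_def .
    qed
    have o: "integrable ?\<mu> ?o"
    proof (rule main(1)[OF mo fin f])
      fix y assume "y \<in> \<Omega>"
      then have y: "q_part p y \<noteq> 0" by (rule q0)
      have "norm (slice_odd p y (p_part p x) (norm (q_part p x))) \<le> C0 * slice_majorant p x (norm (q_part p x)) y"
        using C0(3)[OF y, of "p_part p x" "norm (q_part p x)"] by (simp add: slice_majorant_p_part)
      from weighted_kernel_norm_le[OF q y this K]
      show "norm (?o y) \<le> C * (norm (q_part p y) powr - (real q - 1) * slice_majorant p x (norm (q_part p x)) y * norm (f y))"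
        unfolding C_def .
    qed
    have kle: "norm (?k y) \<le> C * (norm (q_part p y) powr - (real q - 1) * slice_majorant p x (norm (q_part p x)) y * norm (f y))"
      if "y \<in> \<Omega>" for y
      using weighted_kernel_norm_le[OF q q0[OF that] C0(4)[OF q0[OF that]] K]
      unfolding C_def teodorescu_kernel_def cl_mult.scaleR_left .
    have "norm (teodorescu p q \<Omega> f x) \<le> C * enn2real (slice_potential p q \<Omega> f x)"
      unfolding teodorescu_def norm_minus_cancel by (rule main(2)[OF mk fin f kle])
    moreover have "integrable ?\<mu> ?k" by (rule main(1)[OF mk fin f kle])
    moreover have "teodorescu p q \<Omega> f x = - (\<integral>y. ?e y \<partial>?\<mu>) + para (q_dir p x) \<odot> - (\<integral>y. ?o y \<partial>?\<mu>)"
    proof -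
      have "(\<integral>y. ?k y \<partial>?\<mu>) = (\<integral>y. ?e y + para (q_dir p x) \<odot> ?o y \<partial>?\<mu>)"
        unfolding teodorescu_kernel_eq ..
      also have "\<dots> = (\<integral>y. ?e y \<partial>?\<mu>) + (\<integral>y. para (q_dir p x) \<odot> ?o y \<partial>?\<mu>)"
        by (rule Bochner_Integration.integral_add[OF e integrable_bounded_linear[OF cl_mult.bounded_linear_right o]])
      also have "(\<integral>y. para (q_dir p x) \<odot> ?o y \<partial>?\<mu>) = para (q_dir p x) \<odot> (\<integral>y. ?o y \<partial>?\<mu>)"
        by (rule integral_bounded_linear[OF cl_mult.bounded_linear_right o])
      finally show ?thesis
        by (simp only: teodorescu_def cl_mult.minus_right minus_add_distrib)
    qed
    ultimately show "integrable ?\<mu> ?k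
      \<and> norm (teodorescu p q \<Omega> f x) \<le> C * enn2real (slice_potential p q \<Omega> f x)
      \<and> teodorescu p q \<Omega> f x = - (\<integral>y. ?e y \<partial>?\<mu>) + para (q_dir p x) \<odot> - (\<integral>y. ?o y \<partial>?\<mu>)"
      by blast
  qed
qed

text \<open>
  A slice function is determined by a stem function at \<open>(x\<^sub>p, |x\<^sub>q|)\<close>, provided that the direction \<open>x\<^sub>q / |x\<^sub>q|\<close>
  is meaningful; the domain avoids \<open>\<real>\<^bsup>p+1\<^esup>\<close>, which excludes \<open>r = 0\<close>.
\<close>

lemma GS_of_even_odd:
  fixes D :: "('n::{finite,linorder} paravector \<times> real) set"
  assumes "stem_set p D" and off: "p_completion p D \<subseteq> - p_space p"
    and even: "\<And>x r. F\<^sub>1 x (- r) = F\<^sub>1 x r" and odd: "\<And>x r. F\<^sub>2 x (- r) = - F\<^sub>2 x r"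
  shows "(\<lambda>x. F\<^sub>1 (p_part p x) (norm (q_part p x)) + para (q_dir p x) \<odot> F\<^sub>2 (p_part p x) (norm (q_part p x))) \<in> GS p D"
  unfolding GS_def
proof (intro CollectI exI conjI ballI)
  show "stem_function D (\<lambda>(x, r). F\<^sub>1 x r) (\<lambda>(x, r). F\<^sub>2 x r)"
    by (auto simp: stem_function_def even odd)
  fix z assume z: "z \<in> D"
  obtain x r where xr: "z = (x, r)" by (cases z)
  have x: "x \<in> p_space p"
    using assms(1) z xr openin_imp_subset by (fastforce simp: stem_set_def)
  have "F\<^sub>1 (p_part p (x + r *\<^sub>R \<omega>)) (norm (q_part p (x + r *\<^sub>R \<omega>)))
      + para (q_dir p (x + r *\<^sub>R \<omega>)) \<odot> F\<^sub>2 (p_part p (x + r *\<^sub>R \<omega>)) (norm (q_part p (x + r *\<^sub>R \<omega>)))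
      = F\<^sub>1 x r + para \<omega> \<odot> F\<^sub>2 x r" if \<omega>: "\<omega> \<in> q_sphere p" "0 \<le> r" for \<omega>
  proof -
    have "x + r *\<^sub>R \<omega> \<in> p_completion p D"
      using z xr \<omega> by (auto simp: p_completion_def)
    then have "r \<noteq> 0" using off x by auto
    then have "0 < r" using \<omega>(2) by simp
    then show ?thesis using slice_coordinates[OF x \<omega>(1)] by simp
  qed
  then show "case z of (x, r) \<Rightarrow> \<forall>\<omega>\<in>q_sphere p. 0 \<le> r \<longrightarrow>
      F\<^sub>1 (p_part p (x + r *\<^sub>R \<omega>)) (norm (q_part p (x + r *\<^sub>R \<omega>)))
      + para (q_dir p (x + r *\<^sub>R \<omega>)) \<odot> F\<^sub>2 (p_part p (x + r *\<^sub>R \<omega>)) (norm (q_part p (x + r *\<^sub>R \<omega>)))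
      = (case (x, r) of (x, r) \<Rightarrow> F\<^sub>1 x r) + para \<omega> \<odot> (case (x, r) of (x, r) \<Rightarrow> F\<^sub>2 x r)"
    by (simp add: xr)
qed

lemma Lt_space_diff:
  assumes "0 \<le> t" "f \<in> Lt_space t \<Omega>" "g \<in> Lt_space t \<Omega>"
  shows "(\<lambda>x. g x - f x) \<in> Lt_space t \<Omega>"
proof -
  let ?\<mu> = "lebesgue_on \<Omega>"
  from assms have [measurable]: "f \<in> borel_measurable ?\<mu>" "g \<in> borel_measurable ?\<mu>"
    and int: "integrable ?\<mu> (\<lambda>x. norm (f x) powr t)" "integrable ?\<mu> (\<lambda>x. norm (g x) powr t)"
    by (auto simp: Lt_space_def)
  have "integrable ?\<mu> (\<lambda>x. norm (g x - f x) powr t)"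
  proof (rule Bochner_Integration.integrable_bound)
    show "integrable ?\<mu> (\<lambda>x. 2 powr t * (norm (f x) powr t + norm (g x) powr t))"
      using int by simp
    have "norm (g x - f x) powr t \<le> 2 powr t * (norm (f x) powr t + norm (g x) powr t)" for x
    proof -
      have "norm (g x - f x) \<le> 2 * max (norm (f x)) (norm (g x))"
        using norm_triangle_ineq4[of "g x" "f x"] by (auto simp: max_def)
      then have "norm (g x - f x) powr t \<le> (2 * max (norm (f x)) (norm (g x))) powr t"
        using assms(1) by (intro powr_mono2) auto
      also have "\<dots> = 2 powr t * max (norm (f x)) (norm (g x)) powr t"
        by (simp add: powr_mult max_def)
      also have "\<dots> \<le> 2 powr t * (norm (f x) powr t + norm (g x) powr t)"
        by (intro mult_left_mono) (auto simp: max_def)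
      finally show ?thesis .
    qed
    then show "AE x in ?\<mu>. norm (norm (g x - f x) powr t) \<le> norm (2 powr t * (norm (f x) powr t + norm (g x) powr t))"
      by auto
  qed measurable
  then show ?thesis by (simp add: Lt_space_def)
qed

theorem proposition4p4:
  fixes p q :: nat
    and D :: "('n::{finite,linorder} paravector \<times> real) set"
    and \<Omega> :: "'n paravector set"
    and t :: real
  assumes "CARD('n) = p + q" and "q \<ge> 1"
    and "stem_set p D" and "\<Omega> = p_completion p D"
    and "domain \<Omega>" and "p_symmetric p \<Omega>" and "bounded \<Omega>"
    and "\<Omega> \<subseteq> - p_space p"
    and "t > real q"
  shows "(\<forall>f \<in> Lt_GS p t D.
            (AE x in lebesgue_on \<Omega>.
               integrable (lebesgue_on \<Omega>) (\<lambda>y. teodorescu_kernel p q y x \<odot> f y))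
            \<and> teodorescu p q \<Omega> f \<in> Lt_GS p t D)
       \<and> (\<forall>f \<in> Lt_GS p t D. \<forall>\<epsilon> > 0. \<exists>\<delta> > 0. \<forall>g \<in> Lt_GS p t D.
            Lt_norm t \<Omega> (\<lambda>x. g x - f x) < \<delta> \<longrightarrow>
            Lt_norm t \<Omega> (\<lambda>x. teodorescu p q \<Omega> g x - teodorescu p q \<Omega> f x) < \<epsilon>)"
proof -
  let ?\<mu> = "lebesgue_on \<Omega>"
  let ?T = "teodorescu p q \<Omega>"
  let ?k = "\<lambda>f x y. teodorescu_kernel p q y x \<odot> f y"
  have \<Omega>: "\<Omega> \<in> sets lebesgue"
    using assms(5) by (auto simp: domain_def)
  have t: "1 < t" using assms(2,9) by auto
  obtain M where M: "0 \<le> M"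
    "\<And>f. f \<in> Lt_space t \<Omega> \<Longrightarrow> AE x in ?\<mu>. slice_potential p q \<Omega> f x < \<infinity>"
    "\<And>f. f \<in> Lt_space t \<Omega> \<Longrightarrow> (\<integral>\<^sup>+x. ennreal (enn2real (slice_potential p q \<Omega> f x) powr t) \<partial>?\<mu>)
       \<le> ennreal (M * (\<integral>x. norm (f x) powr t \<partial>?\<mu>))"
    using slice_potential_Lt_bound[OF assms(1,2) \<Omega> assms(7-9)] by blast
  obtain C where C: "0 \<le> C" and dom:
    "\<And>f x. f \<in> borel_measurable ?\<mu> \<Longrightarrow> slice_potential p q \<Omega> f x < \<infinity> \<Longrightarrow>
      integrable ?\<mu> (?k f x)
      \<and> norm (?T f x) \<le> C * enn2real (slice_potential p q \<Omega> f x)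
      \<and> ?T f x =
          - (\<integral>y. (1 / (sphere_area q * norm (q_part p y) ^ (q - 1))) *\<^sub>R (slice_even p y (p_part p x) (norm (q_part p x)) \<odot> f y) \<partial>?\<mu>)
          + para (q_dir p x) \<odot>
          - (\<integral>y. (1 / (sphere_area q * norm (q_part p y) ^ (q - 1))) *\<^sub>R (slice_odd p y (p_part p x) (norm (q_part p x)) \<odot> f y) \<partial>?\<mu>)"
    using teodorescu_dominated[OF assms(2,8)] by blast
  interpret finite_measure ?\<mu>
    using \<Omega> assms(7) by (intro finite_measure_lebesgue_on bounded_set_imp_lmeasurable)
  have meas: "f \<in> borel_measurable ?\<mu>" if "f \<in> Lt_space t \<Omega>" for f
    using that by (simp add: Lt_space_def)
  have int: "AE x in ?\<mu>. integrable ?\<mu> (?k f x)" if f: "f \<in> Lt_space t \<Omega>" for f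
    using M(2)[OF f] by eventually_elim (use dom meas[OF f] in blast)
  define A where "A = C powr t * M"
  have A: "0 \<le> A" using M(1) by (simp add: A_def)
  have T_meas: "?T f \<in> borel_measurable ?\<mu>" if f: "f \<in> Lt_space t \<Omega>" for f
  proof -
    have [measurable]: "f \<in> borel_measurable ?\<mu>" by (rule meas[OF f])
    have [measurable]: "(\<lambda>(x, y). teodorescu_kernel p q y x) \<in> borel_measurable (?\<mu> \<Otimes>\<^sub>M ?\<mu>)"
      by (rule borel_measurable_lebesgue_on_pairI[OF borel_measurable_teodorescu_kernel])
    show ?thesis unfolding teodorescu_def[abs_def] by measurable
  qed
  have T_nn: "(\<integral>\<^sup>+x. ennreal (norm (?T f x) powr t) \<partial>?\<mu>) \<le> ennreal (A * (\<integral>x. norm (f x) powr t \<partial>?\<mu>))"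
    if f: "f \<in> Lt_space t \<Omega>" for f
  proof -
    have "AE x in ?\<mu>. norm (?T f x) powr t \<le> C powr t * enn2real (slice_potential p q \<Omega> f x) powr t"
      using M(2)[OF f]
    proof eventually_elim
      case (elim x)
      then have "norm (?T f x) \<le> C * enn2real (slice_potential p q \<Omega> f x)"
        using dom[OF meas[OF f]] by blast
      then have "norm (?T f x) powr t \<le> (C * enn2real (slice_potential p q \<Omega> f x)) powr t"
        using t by (intro powr_mono2) auto
      then show ?case using C by (simp add: powr_mult)
    qed
    then have "(\<integral>\<^sup>+x. ennreal (norm (?T f x) powr t) \<partial>?\<mu>)
        \<le> (\<integral>\<^sup>+x. ennreal (C powr t) * ennreal (enn2real (slice_potential p q \<Omega> f x) powr t) \<partial>?\<mu>)"
      by (intro nn_integral_mono_AE) (auto elim!: eventually_mono simp: ennreal_mult[symmetric] intro!: ennreal_leI)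
    also have "\<dots> \<le> ennreal (C powr t) * (\<integral>\<^sup>+x. ennreal (enn2real (slice_potential p q \<Omega> f x) powr t) \<partial>?\<mu>)"
    proof -
      have [measurable]: "slice_potential p q \<Omega> f \<in> borel_measurable ?\<mu>"
        by (rule borel_measurable_slice_potential[OF \<Omega> assms(7) meas[OF f]])
      show ?thesis by (subst nn_integral_cmult) simp_all
    qed
    also have "\<dots> \<le> ennreal (C powr t) * ennreal (M * (\<integral>x. norm (f x) powr t \<partial>?\<mu>))"
      by (intro mult_left_mono M(3)[OF f]) simp
    also have "\<dots> = ennreal (A * (\<integral>x. norm (f x) powr t \<partial>?\<mu>))"
      using M(1) by (simp add: A_def ennreal_mult[symmetric] mult.assoc)
    finally show ?thesis .
  qed
  have T_Lt: "?T f \<in> Lt_space t \<Omega>" if f: "f \<in> Lt_space t \<Omega>" for f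
  proof -
    have [measurable]: "?T f \<in> borel_measurable ?\<mu>" by (rule T_meas[OF f])
    have "integrable ?\<mu> (\<lambda>x. norm (?T f x) powr t)"
    proof (rule integrableI_bounded)
      show "(\<integral>\<^sup>+x. ennreal (norm (norm (?T f x) powr t)) \<partial>?\<mu>) < \<infinity>"
        using T_nn[OF f] by (simp add: order.strict_trans1)
    qed measurable
    then show ?thesis by (simp add: Lt_space_def)
  qed
  have T_norm: "Lt_norm t \<Omega> (?T f) \<le> A powr (1 / t) * Lt_norm t \<Omega> f" if f: "f \<in> Lt_space t \<Omega>" for f
  proof -
    have [measurable]: "?T f \<in> borel_measurable ?\<mu>" by (rule T_meas[OF f])
    have "(\<integral>x. norm (?T f x) powr t \<partial>?\<mu>) \<le> A * (\<integral>x. norm (f x) powr t \<partial>?\<mu>)"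
    proof -
      have "(\<integral>x. norm (?T f x) powr t \<partial>?\<mu>) = enn2real (\<integral>\<^sup>+x. ennreal (norm (?T f x) powr t) \<partial>?\<mu>)"
        by (rule integral_eq_nn_integral) auto
      also have "\<dots> \<le> enn2real (ennreal (A * (\<integral>x. norm (f x) powr t \<partial>?\<mu>)))"
        by (rule enn2real_mono[OF T_nn[OF f]]) simp
      finally show ?thesis using A by simp
    qed
    then have "Lt_norm t \<Omega> (?T f) \<le> (A * (\<integral>x. norm (f x) powr t \<partial>?\<mu>)) powr (1 / t)"
      unfolding Lt_norm_def using t by (intro powr_mono2) auto
    then show ?thesis using A by (simp add: Lt_norm_def powr_mult)
  qed
  have GS: "?T f \<in> Lt_GS p t D" if f: "f \<in> Lt_GS p t D" for f
  proof -
    have fL: "f \<in> Lt_space t \<Omega>" using f by (simp add: Lt_GS_def assms(4))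
    define F\<^sub>1 where "F\<^sub>1 x r = - (\<integral>y. (1 / (sphere_area q * norm (q_part p y) ^ (q - 1))) *\<^sub>R (slice_even p y x r \<odot> f y) \<partial>?\<mu>)" for x r
    define F\<^sub>2 where "F\<^sub>2 x r = - (\<integral>y. (1 / (sphere_area q * norm (q_part p y) ^ (q - 1))) *\<^sub>R (slice_odd p y x r \<odot> f y) \<partial>?\<mu>)" for x r
    have gs: "(\<lambda>x. F\<^sub>1 (p_part p x) (norm (q_part p x)) + para (q_dir p x) \<odot> F\<^sub>2 (p_part p x) (norm (q_part p x))) \<in> GS p D"
      using assms(3,4,8)
      by (intro GS_of_even_odd) (simp_all add: F\<^sub>1_def F\<^sub>2_def slice_even_minus slice_odd_minus cl_mult.minus_left)
    have ae: "AE x in ?\<mu>. ?T f x = F\<^sub>1 (p_part p x) (norm (q_part p x)) + para (q_dir p x) \<odot> F\<^sub>2 (p_part p x) (norm (q_part p x))"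
      using M(2)[OF fL] unfolding F\<^sub>1_def F\<^sub>2_def by eventually_elim (use dom meas[OF fL] in blast)
    show ?thesis
      unfolding Lt_GS_def assms(4)[symmetric] by (intro CollectI conjI T_Lt[OF fL]) (rule bexI[OF _ gs], rule ae)
  qed
  show ?thesis
  proof (intro conjI ballI allI impI)
    fix f assume f: "f \<in> Lt_GS p t D"
    then have fL: "f \<in> Lt_space t \<Omega>" by (simp add: Lt_GS_def assms(4))
    show "AE x in ?\<mu>. integrable ?\<mu> (?k f x)" by (rule int[OF fL])
    show "?T f \<in> Lt_GS p t D" by (rule GS[OF f])
    fix \<epsilon> :: real assume \<epsilon>: "0 < \<epsilon>"
    define \<delta> where "\<delta> = \<epsilon> / (A powr (1 / t) + 1)"
    have \<delta>: "0 < \<delta>" using \<epsilon> by (simp add: \<delta>_def add_nonneg_pos)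
    have "Lt_norm t \<Omega> (\<lambda>x. ?T g x - ?T f x) < \<epsilon>"
      if g: "g \<in> Lt_GS p t D" and less: "Lt_norm t \<Omega> (\<lambda>x. g x - f x) < \<delta>" for g
    proof -
      have gL: "g \<in> Lt_space t \<Omega>" using g by (simp add: Lt_GS_def assms(4))
      have dL: "(\<lambda>x. g x - f x) \<in> Lt_space t \<Omega>"
        using t by (intro Lt_space_diff fL gL) simp
      \<comment> \<open>Linearity of the transform holds only where both integrals converge.\<close>
      have "AE x in ?\<mu>. ?T g x - ?T f x = ?T (\<lambda>x. g x - f x) x"
        using int[OF fL] int[OF gL]
        by eventually_elim (simp add: teodorescu_def cl_mult.diff_right Bochner_Integration.integral_diff)
      then have "Lt_norm t \<Omega> (\<lambda>x. ?T g x - ?T f x) = Lt_norm t \<Omega> (?T (\<lambda>x. g x - f x))"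
        unfolding Lt_norm_def
        using T_meas[OF fL] T_meas[OF gL] T_meas[OF dL]
        by (intro arg_cong[where f = "\<lambda>u. u powr (1 / t)"] integral_cong_AE) (auto elim: eventually_mono)
      also have "\<dots> \<le> A powr (1 / t) * Lt_norm t \<Omega> (\<lambda>x. g x - f x)"
        by (rule T_norm[OF dL])
      also have "\<dots> \<le> A powr (1 / t) * \<delta>"
        using less by (intro mult_left_mono) auto
      also have "\<dots> < (A powr (1 / t) + 1) * \<delta>"
        using \<delta> by (simp add: algebra_simps)
      also have "\<dots> = \<epsilon>"
        by (simp add: \<delta>_def add_nonneg_eq_0_iff)
      finally show ?thesis .
    qed
    with \<delta> show "\<exists>\<delta>>0. \<forall>g\<in>Lt_GS p t D. Lt_norm t \<Omega> (\<lambda>x. g x - f x) < \<delta> \<longrightarrow> Lt_norm t \<Omega> (\<lambda>x. ?T g x - ?T f x) < \<epsilon>"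
      by blast
  qed
qed

end
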